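(* Let $a>\frac{r-1}{2}$, $b>\frac{r-1}{2}-a$ and $c>0$. Let $X$ and $Y$ be two independent random matrices valued in $\Omega_+$ such that $X\sim\mathcal{MK}(a,b,c\mathbf{e})$ and $Y\sim\mathcal{W}(a+b,c\mathbf{e})$. Then the random matrices $$U:=\mathbb{P}\big((\mathbf{e}+X)^{-1/2}\big)Y,\qquad V:=\mathbb{P}\big((\mathbf{e}+U)^{1/2}\big)X$$ are independent. Furthermore, $U\sim\mathcal{MK}(a+b,-b,c\mathbf{e})$ and $V\sim\mathcal{W}(a,c\mathbf{e})$.
   Context: Let $r\ge 1$ be an integer. $\Omega$ is the linear space of real symmetric $r\times r$ matrices with inner product $\langle x,y\rangle=\mathrm{tr}(xy)$, $\Omega_+\subset\Omega$ is the cone of positive definite matrices, and $\mathbf{e}$ is the $r\times r$ identity matrix. For $y\in\Omega_+$, $\mathbb{P}(y)$ is the endomorphism of $\Omega$ given by $\mathbb{P}(y)x=yxy$; $y^{1/2}\in\Omega_+$ is the positive definite square root and $y^{-1/2}=(y^{1/2})^{-1}$. Densities are with respect to Lebesgue measure on $\Omega$. For $b>\frac{r-1}{2}$ and $\Sigma\in\Omega_+$, the Wishart distribution $\mathcal{W}(b,\Sigma)$ is the probability law on $\Omega_+$ with density proportional to $(\det y)^{b-\frac{r+1}{2}}\exp(-\langle\Sigma,y\rangle)\,I_{\Omega_+}(y)$. For $a>\frac{r-1}{2}$, $b\in\mathbb{R}$ and $\Sigma\in\Omega_+$, the matrix-Kummer distribution $\mathcal{MK}(a,b,\Sigma)$ is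 the probability law on $\Omega_+$ with density proportional to $(\det x)^{a-\frac{r+1}{2}}(\det(\mathbf{e}+x))^{-(a+b)}\exp(-\langle\Sigma,x\rangle)\,I_{\Omega_+}(x)$. *)

theory Defs
  imports "HOL-Probability.Probability"
begin

definition sym_matrices :: "(real^'n^'n) set" where
  "sym_matrices = {x. transpose x = x}"

definition pos_def_cone :: "(real^'n^'n) set" where
  "pos_def_cone = {x \<in> sym_matrices. \<forall>v. v \<noteq> 0 \<longrightarrow> v \<bullet> (x *v v) > 0}"

text \<open>
  The entries of a symmetric matrix \<open>x\<close> are indexed by the unordered pairs
  \<open>{i, j}\<close>, singletons for the diagonal; \<open>sym_of_entries\<close> identifies
  \<open>\<real>\<close>-valued families on these pairs with the space of symmetric matrices.
\<close>

definition entry_indices :: "'n::finite set set" where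
  "entry_indices = {{i, j} | i j. True}"

definition sym_of_entries :: "('n set \<Rightarrow> real) \<Rightarrow> real^'n^'n" where
  "sym_of_entries f = (\<chi> i j. f {i, j})"

text \<open>
  Lebesgue measure on the symmetric matrices, as a Borel measure on all square
  matrices concentrated on the symmetric ones. It is the product of the Lebesgue
  measures of the free entries; the Lebesgue measure normalized by the inner product
  \<open>trace (x ** y)\<close> is a constant multiple of it, and the constant cancels
  in \<open>law_proportional_to\<close>.
\<close>

definition sym_lborel :: "(real^'n^'n) measure" where
  "sym_lborel = distr (\<Pi>\<^sub>M s\<in>entry_indices. lborel) borel sym_of_entries"

lemma measurable_sym_of_entries [measurable]:
  "(sym_of_entries :: _ \<Rightarrow> real^'n^'n) \<in> (\<Pi>\<^sub>M s\<in>entry_indices. lborel) \<rightarrow>\<^sub>M borel"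
proof -
  have comp: "(\<lambda>f. f {i, j}) \<in> borel_measurable (\<Pi>\<^sub>M s\<in>entry_indices. lborel :: real measure)"
    for i j :: 'n
  proof -
    have "{i, j} \<in> entry_indices" by (auto simp: entry_indices_def)
    then show ?thesis using measurable_component_singleton[of "{i, j}" entry_indices "\<lambda>_. lborel"]
      by simp
  qed
  have entry: "(\<lambda>f. sym_of_entries f \<bullet> axis i (axis j 1))
      \<in> borel_measurable (\<Pi>\<^sub>M s\<in>entry_indices. lborel)" for i j :: 'n
    using comp[of i j] by (simp add: sym_of_entries_def inner_axis)
  show ?thesis
    by (subst borel_measurable_euclidean_space) (auto simp: Basis_vec_def intro: entry)
qed

lemma sets_sym_lborel [measurable_cong]: "sets sym_lborel = sets borel"
  by (simp add: sym_lborel_def)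

lemma AE_sym_lborel_sym: "AE x in (sym_lborel :: (real^'n^'n) measure). x \<in> sym_matrices"
proof -
  have "closed (sym_matrices :: (real^'n^'n) set)"
    unfolding sym_matrices_def transpose_def by (intro closed_Collect_eq continuous_intros)
  then have "{x \<in> space borel. x \<in> (sym_matrices :: (real^'n^'n) set)} \<in> sets borel"
    using borel_closed by simp
  then show ?thesis
    unfolding sym_lborel_def
    by (subst AE_distr_iff)
       (auto simp: sym_matrices_def sym_of_entries_def transpose_def insert_commute)
qed

text \<open>
  The probability law with density proportional to \<open>f \<ge> 0\<close>. This is meaningful only
  if the total mass of \<open>f\<close> is positive and finite.
\<close>

definition law_proportional_to :: "'a measure \<Rightarrow> ('a \<Rightarrow> real) \<Rightarrow> 'a measure" where
  "law_proportional_to N f = density N (\<lambda>x. ennreal (f x) / (\<integral>\<^sup>+ y. ennreal (f y) \<partial>N))"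

definition wishart :: "real \<Rightarrow> real^'n^'n \<Rightarrow> (real^'n^'n) measure" where
  "wishart b \<Sigma> = law_proportional_to sym_lborel
     (\<lambda>y. det y powr (b - (real CARD('n) + 1) / 2) * exp (- trace (\<Sigma> ** y))
          * indicator pos_def_cone y)"

definition matrix_kummer :: "real \<Rightarrow> real \<Rightarrow> real^'n^'n \<Rightarrow> (real^'n^'n) measure" where
  "matrix_kummer a b \<Sigma> = law_proportional_to sym_lborel
     (\<lambda>x. det x powr (a - (real CARD('n) + 1) / 2) * det (mat 1 + x) powr (- (a + b))
          * exp (- trace (\<Sigma> ** x)) * indicator pos_def_cone x)"

definition quad_rep :: "real^'n^'n \<Rightarrow> real^'n^'n \<Rightarrow> real^'n^'n" where
  "quad_rep y x = y ** x ** y"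

text \<open>Well defined on the cone of positive definite matrices only.\<close>

definition msqrt :: "real^'n^'n \<Rightarrow> real^'n^'n" where
  "msqrt y = (THE s. s \<in> pos_def_cone \<and> s ** s = y)"

end

theory Submission
  imports Defs
begin

text \<open>
  Substituting \<open>u = (e + x)\<^sup>-\<^sup>1\<^sup>/\<^sup>2 y (e + x)\<^sup>-\<^sup>1\<^sup>/\<^sup>2\<close> for \<open>y\<close> at fixed \<open>x\<close> has a constant
  Jacobian, a power of \<open>det (e + x)\<close>, and turns the product of the two densities into
  \<open>det x\<close> and \<open>det u\<close> to powers, times \<open>exp (- c (tr x + tr u + tr (x u)))\<close>. This joint density
  of \<open>X\<close> and \<open>U\<close> is symmetric under swapping the matrices together with \<open>a\<close> and \<open>a + b\<close>, so the
  same substitution read backwards, now at fixed \<open>u\<close>, gives the product form of the density of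
  \<open>(U, V)\<close>. The normalizing constants need not be computed: the products of the two
  constants before and after agree.
\<close>

subsection \<open>Positive definite matrices and their square roots\<close>

text \<open>With \<open>r = CARD('n)\<close>, congruence by \<open>A\<close> multiplies Lebesgue
  measure on the symmetric matrices by the absolute value of \<open>det A\<close> to the power
  \<open>r + 1\<close>. For \<open>A = (e + x)^(1/2)\<close> this is \<open>det (e + x)\<close> to
  the power \<open>(r + 1) / 2\<close>, exactly what is needed to cancel the exponents
  \<open>- (a + b)\<close> of the Kummer density and \<open>a + b - (r + 1) / 2\<close> of the
  Wishart density. In the backward reading the Kummer parameters \<open>(a', b')\<close> must
  satisfy \<open>a' = a + b\<close> and \<open>a' + b' = a\<close>, hence \<open>b' = - b\<close>.

  Two prerequisites shape the development. Since \<open>msqrt\<close> is a definite description,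
  existence, uniqueness and continuity of the positive definite root have to be established; the
  argument is topological and uses no diagonalization. The Jacobian is found by splitting
  \<open>A\<close> into elementary matrices, whose action on the free entries is a rescaling, a
  permutation or a shear.\<close>

lemma quad_form_eq: "(v::real^'n) \<bullet> ((A::real^'n^'n) *v v) = (\<Sum>i\<in>UNIV. v$i * (\<Sum>j\<in>UNIV. A$i$j * v$j))"
  by (simp add: inner_vec_def matrix_vector_mult_def)

lemma inner_symm_matrix:
  fixes A :: "real^'n^'n"
  assumes "transpose A = A"
  shows "(A *v v) \<bullet> w = v \<bullet> (A *v w)"
  by (metis assms dot_lmul_matrix vector_transpose_matrix)

lemma continuous_on_matrix_mult [continuous_intros]:
  fixes f :: "'a::topological_space \<Rightarrow> real^'n^'m" and g :: "'a \<Rightarrow> real^'k^'n"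
  assumes "continuous_on S f" "continuous_on S g"
  shows "continuous_on S (\<lambda>x. f x ** g x)"
  unfolding matrix_matrix_mult_def by (intro continuous_intros assms)

lemma continuous_on_quad_form [continuous_intros]:
  fixes f :: "'a::topological_space \<Rightarrow> real^'n^'n" and g :: "'a \<Rightarrow> real^'n"
  assumes "continuous_on S f" "continuous_on S g"
  shows "continuous_on S (\<lambda>x. g x \<bullet> (f x *v g x))"
  unfolding quad_form_eq by (intro continuous_intros assms)

lemma subspace_sym_matrices: "subspace (sym_matrices :: (real^'n^'n) set)"
  by (auto simp: sym_matrices_def transpose_def subspace_def vec_eq_iff)

text \<open>Scaling reduces positivity to unit vectors. The excluded set then appears as a
  projection along the compact sphere, which is what makes it closed in
  \<open>openin_pos_def_cone\<close>.\<close>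

lemma pos_def_cone_eq:
  "(pos_def_cone :: (real^'n^'n) set) = sym_matrices \<inter> - {x. \<exists>v. v \<in> sphere 0 1 \<and> v \<bullet> (x *v v) \<le> 0}"
proof -
  have "(\<forall>v. v \<noteq> 0 \<longrightarrow> v \<bullet> (x *v v) > 0) \<longleftrightarrow> (\<forall>v\<in>sphere 0 1. v \<bullet> (x *v v) > 0)" for x :: "real^'n^'n"
  proof safe
    fix v :: "real^'n"
    assume *: "\<forall>v\<in>sphere 0 1. v \<bullet> (x *v v) > 0" and v: "v \<noteq> 0"
    have "0 < (v /\<^sub>R norm v) \<bullet> (x *v (v /\<^sub>R norm v))"
      using v by (intro bspec[OF *]) auto
    also have "\<dots> = (v \<bullet> (x *v v)) / (norm v)^2"
      by (simp add: matrix_vector_mult_scaleR power2_eq_square divide_simps)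
    finally show "v \<bullet> (x *v v) > 0"
      using v by (simp add: zero_less_divide_iff)
  qed (metis norm_zero dist_0_norm mem_sphere zero_neq_one)
  then show ?thesis
    unfolding pos_def_cone_def by (simp only: not_less[symmetric]) blast
qed

text \<open>Openness is relative to the subspace of symmetric matrices, the ambient space in which
  invariance of domain is applied to squaring.\<close>

lemma openin_pos_def_cone: "openin (top_of_set sym_matrices) (pos_def_cone :: (real^'n^'n) set)"
proof -
  have "closed {p :: (real^'n) \<times> (real^'n^'n). fst p \<bullet> (snd p *v fst p) \<le> 0}"
    by (intro closed_Collect_le continuous_intros)
  from closed_compact_projection[OF _ this, of "sphere 0 1"]
  have "closed {x :: real^'n^'n. \<exists>v. v \<in> sphere 0 1 \<and> v \<bullet> (x *v v) \<le> 0}"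
    by simp
  then show ?thesis
    unfolding pos_def_cone_eq openin_open by blast
qed

lemma closed_sym_matrices: "closed (sym_matrices :: (real^'n^'n) set)"
  by (rule closed_subspace[OF subspace_sym_matrices])

lemma pos_def_cone_borel [measurable]: "(pos_def_cone :: (real^'n^'n) set) \<in> sets borel"
  using openin_pos_def_cone closed_sym_matrices
  by (metis openin_open borel_closed borel_open sets.Int)

lemma convex_pos_def_cone: "convex (pos_def_cone :: (real^'n^'n) set)"
proof (rule convexI)
  fix x y :: "real^'n^'n" and u v :: real
  assume x: "x \<in> pos_def_cone" and y: "y \<in> pos_def_cone" and uv: "0 \<le> u" "0 \<le> v" "u + v = 1"
  have "0 < w \<bullet> ((u *\<^sub>R x + v *\<^sub>R y) *v w)" if "w \<noteq> 0" for w
  proof -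
    have "w \<bullet> (x *v w) > 0" "w \<bullet> (y *v w) > 0"
      using x y that by (auto simp: pos_def_cone_def)
    moreover have "w \<bullet> ((u *\<^sub>R x + v *\<^sub>R y) *v w) = u * (w \<bullet> (x *v w)) + v * (w \<bullet> (y *v w))"
      by (simp add: algebra_simps inner_add_right flip: scaleR_matrix_vector_assoc)
    ultimately show ?thesis
      using uv by (cases "u = 0") (auto intro: add_pos_nonneg)
  qed
  moreover have "u *\<^sub>R x + v *\<^sub>R y \<in> sym_matrices"
    using x y by (auto simp: pos_def_cone_def intro!: subspace_add subspace_mul subspace_sym_matrices)
  ultimately show "u *\<^sub>R x + v *\<^sub>R y \<in> pos_def_cone"
    by (simp add: pos_def_cone_def)
qed

lemma pos_def_transpose: "x \<in> pos_def_cone \<Longrightarrow> transpose x = x"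
  by (simp add: pos_def_cone_def sym_matrices_def)

lemma pos_def_mat_1: "mat 1 \<in> (pos_def_cone :: (real^'n^'n) set)"
  by (auto simp: pos_def_cone_def sym_matrices_def)

lemma pos_def_mat_1_add:
  assumes "x \<in> pos_def_cone"
  shows "mat 1 + x \<in> pos_def_cone"
proof -
  have "transpose (mat 1 + x) = mat 1 + x"
    using pos_def_transpose[OF assms] by (simp add: transpose_def vec_eq_iff mat_def)
  moreover have "v \<bullet> ((mat 1 + x) *v v) > 0" if "v \<noteq> 0" for v
  proof -
    have "v \<bullet> (x *v v) > 0"
      using assms that by (auto simp: pos_def_cone_def)
    then show ?thesis
      by (simp add: matrix_vector_mult_add_rdistrib inner_add_right add_nonneg_pos)
  qed
  ultimately show ?thesis
    by (simp add: pos_def_cone_def sym_matrices_def)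
qed

lemma pos_def_invertible:
  assumes "x \<in> pos_def_cone"
  shows "invertible x"
proof -
  have "v = 0" if "x *v v = 0" for v
    using assms that by (force simp: pos_def_cone_def)
  then show ?thesis
    by (simp add: invertible_left_inverse matrix_left_invertible_ker)
qed

lemma pos_def_congruence:
  fixes A x :: "real^'n^'n"
  assumes x: "x \<in> pos_def_cone" and A: "invertible A"
  shows "A ** x ** transpose A \<in> pos_def_cone"
proof -
  have "v \<bullet> ((A ** x ** transpose A) *v v) > 0" if "v \<noteq> 0" for v
  proof -
    have "v \<bullet> ((A ** x ** transpose A) *v v) = (transpose A *v v) \<bullet> (x *v (transpose A *v v))"
      by (simp add: dot_lmul_matrix vector_transpose_matrix flip: matrix_vector_mul_assoc)
    moreover have "transpose A *v v \<noteq> 0"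
      using A that by (metis invertible_det_nz det_transpose inj_matrix_vector_mult inj_eq matrix_vector_mult_0_right)
    ultimately show ?thesis
      using x by (simp add: pos_def_cone_def)
  qed
  then show ?thesis
    using pos_def_transpose[OF x]
    by (simp add: pos_def_cone_def sym_matrices_def matrix_transpose_mul transpose_transpose matrix_mul_assoc)
qed

lemma pos_def_square:
  assumes "s \<in> pos_def_cone"
  shows "s ** s \<in> pos_def_cone"
  using pos_def_congruence[OF pos_def_mat_1 pos_def_invertible[OF assms]] pos_def_transpose[OF assms]
  by simp

section \<open>Existence, uniqueness and continuity of the square root\<close>

text \<open>A zero of a nonnegative form is a minimum. Moving from \<open>v\<close> by
  \<open>t\<close> against \<open>x *v v\<close> changes the form by
  \<open>- 2 * t * N + t\<^sup>2 * K\<close>, which is negative for small positive \<open>t\<close>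
  unless \<open>N = 0\<close>.\<close>

lemma pos_semidef_kernel:
  fixes x :: "real^'n^'n"
  assumes sym: "transpose x = x" and nonneg: "\<And>w. w \<bullet> (x *v w) \<ge> 0" and v: "v \<bullet> (x *v v) = 0"
  shows "x *v v = 0"
proof (rule ccontr)
  assume nz: "x *v v \<noteq> 0"
  define N K where "N = (x *v v) \<bullet> (x *v v)" and "K = (x *v v) \<bullet> (x *v (x *v v))"
  have N: "N > 0" and K: "K \<ge> 0"
    using nz nonneg by (auto simp: N_def K_def)
  have "0 \<le> - 2 * t * N + t\<^sup>2 * K" for t
  proof -
    have "(v - t *\<^sub>R (x *v v)) \<bullet> (x *v (v - t *\<^sub>R (x *v v))) = - 2 * t * N + t\<^sup>2 * K"
      using v inner_symm_matrix[OF sym, of v "x *v v"]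
      by (simp add: N_def K_def matrix_vector_mult_diff_distrib matrix_vector_mult_scaleR
          inner_diff_left inner_diff_right power2_eq_square inner_commute algebra_simps)
    then show ?thesis
      using nonneg by metis
  qed
  \<comment> \<open>This step length \<open>t\<close> satisfies
    \<open>t * K \<le> N < 2 * N\<close>; the summand 1 keeps the denominator positive when
    \<open>K = 0\<close>.\<close>
  from this[of "N / (K + 1)"] have "0 \<le> N / (K + 1) * (N / (K + 1) * K - 2 * N)"
    by (simp add: algebra_simps power2_eq_square)
  moreover have "N / (K + 1) > 0"
    using N K by simp
  ultimately have "0 \<le> N / (K + 1) * K - 2 * N"
    by (metis mult_pos_neg not_less)
  then have "2 * N \<le> N / (K + 1) * K"
    by simp
  also have "\<dots> \<le> N"
    using N K by (simp add: divide_simps)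
  finally show False
    using N by simp
qed

lemma trace_congruence:
  fixes s d :: "real^'n^'n"
  assumes "transpose d = d"
  shows "trace (d ** s ** d) = (\<Sum>i\<in>UNIV. row i d \<bullet> (s *v row i d))"
proof -
  have "d $ j $ i = d $ i $ j" for i j
    using assms by (auto simp: transpose_def vec_eq_iff)
  then show ?thesis
    by (simp add: trace_def quad_form_eq matrix_matrix_mult_def row_def sum_distrib_left sum_distrib_right
        mult.assoc) (rule sum.cong[OF refl], rule sum.swap)
qed

text \<open>
  If \<open>s\<^sup>2 = t\<^sup>2\<close> and \<open>d = s - t\<close>, then \<open>s d + d t = 0\<close>, so the
  nonnegative numbers \<open>trace (d s d)\<close> and \<open>trace (d t d)\<close> add up to zero.
\<close>

lemma inj_on_square_pos_def: "inj_on (\<lambda>s. s ** s) (pos_def_cone :: (real^'n^'n) set)"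
proof (rule inj_onI)
  fix s t :: "real^'n^'n"
  assume s: "s \<in> pos_def_cone" and t: "t \<in> pos_def_cone" and eq: "s ** s = t ** t"
  define d where "d = s - t"
  have d: "transpose d = d"
    using pos_def_transpose[OF s] pos_def_transpose[OF t] by (simp add: d_def transpose_def vec_eq_iff)
  have "trace (d ** s ** d) + trace (d ** t ** d) = trace (d ** (s ** d + d ** t))"
    by (metis matrix_add_ldistrib matrix_mul_assoc trace_add trace_mul_sym)
  also have "s ** d + d ** t = 0"
    using eq by (simp add: d_def matrix_matrix_mult_def vec_eq_iff algebra_simps sum_subtractf)
  finally have sum0: "trace (d ** s ** d) + trace (d ** t ** d) = 0"
    by (simp add: trace_def)
  have nonneg: "row i d \<bullet> (r *v row i d) \<ge> 0" if "r \<in> pos_def_cone" for i r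
    using that by (cases "row i d = 0") (auto simp: pos_def_cone_def less_imp_le)
  have "trace (d ** s ** d) \<ge> 0" "trace (d ** t ** d) \<ge> 0"
    using nonneg s t by (auto simp: trace_congruence[OF d] intro!: sum_nonneg)
  then have "(\<Sum>i\<in>UNIV. row i d \<bullet> (s *v row i d)) = 0"
    using sum0 by (simp add: trace_congruence[OF d])
  then have "row i d \<bullet> (s *v row i d) = 0" for i
    using nonneg[OF s] by (subst (asm) sum_nonneg_eq_0_iff) auto
  then have "row i d = 0" for i
    using s by (force simp: pos_def_cone_def)
  then have "d = 0"
    by (simp add: row_def vec_eq_iff)
  then show "s = t"
    by (simp add: d_def)
qed

text \<open>The norm on matrices is the Frobenius norm. The identity turns a bound on the squares
  into a bound on the roots.\<close>

lemma norm_square_symm: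
  fixes s :: "real^'n^'n"
  assumes "transpose s = s"
  shows "(norm s)\<^sup>2 = trace (s ** s)"
proof -
  have "s $ j $ i = s $ i $ j" for i j
    using assms by (auto simp: transpose_def vec_eq_iff)
  then show ?thesis
    by (simp add: power2_norm_eq_inner inner_vec_def trace_def matrix_matrix_mult_def)
qed

text \<open>The traces of the squares converge, so the roots are bounded and a subsequence converges
  to a positive semidefinite root \<open>l\<close> of \<open>y\<close>. A vector on which the form
  of \<open>l\<close> vanishes lies in the kernel of \<open>l\<close>, hence in that of
  \<open>y\<close>; so \<open>l\<close> is definite. This is the closedness half of the surjectivity
  of squaring.\<close>

lemma pos_def_square_limit:
  fixes s :: "nat \<Rightarrow> real^'n^'n"
  assumes s: "\<And>n. s n \<in> pos_def_cone" and lim: "(\<lambda>n. s n ** s n) \<longlonglongrightarrow> y" and y: "y \<in> pos_def_cone"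
  shows "\<exists>l\<in>pos_def_cone. l ** l = y"
proof -
  have "(\<lambda>n. trace (s n ** s n)) \<longlonglongrightarrow> trace y"
    unfolding trace_def by (intro tendsto_intros lim)
  then have "Bseq (\<lambda>n. (norm (s n))\<^sup>2)"
    by (simp add: norm_square_symm pos_def_transpose s convergentI convergent_imp_Bseq)
  then obtain K where K: "\<And>n. (norm (s n))\<^sup>2 \<le> K"
    by (auto simp: Bseq_def)
  have "norm (s n) \<le> sqrt K" for n
    using K[of n] by (simp add: real_le_rsqrt)
  then have "bounded (range s)"
    by (auto simp: bounded_iff)
  then obtain l r where r: "strict_mono r" and l: "(s \<circ> r) \<longlonglongrightarrow> l"
    using bounded_imp_convergent_subsequence by blast
  have ll: "(\<lambda>n. (s \<circ> r) n ** (s \<circ> r) n) \<longlonglongrightarrow> l ** l"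
    unfolding matrix_matrix_mult_def by (intro tendsto_intros l)
  moreover have "(\<lambda>n. (s \<circ> r) n ** (s \<circ> r) n) \<longlonglongrightarrow> y"
    using LIMSEQ_subseq_LIMSEQ[OF lim r] by (simp add: o_def)
  ultimately have eq: "l ** l = y"
    by (rule LIMSEQ_unique)
  have sym: "transpose l = l"
    using closed_sequentially[OF closed_sym_matrices _ l] s
    by (auto simp: pos_def_cone_def sym_matrices_def)
  have nonneg: "v \<bullet> (l *v v) \<ge> 0" for v
  proof (rule LIMSEQ_le_const)
    show "(\<lambda>n. v \<bullet> ((s \<circ> r) n *v v)) \<longlonglongrightarrow> v \<bullet> (l *v v)"
      unfolding quad_form_eq by (intro tendsto_intros l)
    show "\<exists>N. \<forall>n\<ge>N. 0 \<le> v \<bullet> ((s \<circ> r) n *v v)"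
      using s by (cases "v = 0") (auto simp: pos_def_cone_def less_imp_le)
  qed
  have "v \<bullet> (l *v v) > 0" if "v \<noteq> 0" for v
  proof (rule ccontr)
    assume "\<not> 0 < v \<bullet> (l *v v)"
    then have "l *v v = 0"
      using nonneg[of v] by (intro pos_semidef_kernel sym nonneg) auto
    then have "v \<bullet> (y *v v) = 0"
      by (simp flip: eq matrix_vector_mul_assoc)
    then show False
      using y that by (force simp: pos_def_cone_def)
  qed
  then show ?thesis
    using sym eq by (auto simp: pos_def_cone_def sym_matrices_def)
qed

lemma openin_square_pos_def:
  assumes "openin (top_of_set pos_def_cone) U"
  shows "openin (top_of_set pos_def_cone) ((\<lambda>s::real^'n^'n. s ** s) ` U)"
proof -
  have U: "U \<subseteq> pos_def_cone"
    using assms openin_imp_subset by blast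
  have "openin (top_of_set sym_matrices) ((\<lambda>s::real^'n^'n. s ** s) ` U)"
  proof (rule invariance_of_domain_subspaces)
    show "openin (top_of_set sym_matrices) U"
      using assms openin_pos_def_cone by (rule openin_trans)
    show "inj_on (\<lambda>s. s ** s) U"
      using inj_on_square_pos_def U by (rule inj_on_subset)
    show "(\<lambda>s. s ** s) \<in> U \<rightarrow> sym_matrices"
      using U pos_def_square by (auto simp: pos_def_cone_def)
  qed (auto intro!: subspace_sym_matrices continuous_intros)
  then show ?thesis
    using U pos_def_square by (elim openin_subset_trans) (auto simp: pos_def_cone_def)
qed

text \<open>
  Squaring is an open map on the cone by invariance of domain, and its image is closed
  in the cone; connectedness of the cone then gives surjectivity.
\<close>

lemma square_image_pos_def: "(\<lambda>s. s ** s) ` pos_def_cone = (pos_def_cone :: (real^'n^'n) set)"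
proof -
  let ?Q = "(\<lambda>s. s ** s) ` (pos_def_cone :: (real^'n^'n) set)"
  have "openin (top_of_set pos_def_cone) ?Q"
    by (intro openin_square_pos_def) simp
  moreover have "closedin (top_of_set pos_def_cone) ?Q"
    unfolding closedin_limpt
  proof (intro conjI allI impI)
    show "?Q \<subseteq> pos_def_cone"
      using pos_def_square by auto
    fix y assume "y islimpt ?Q \<and> y \<in> pos_def_cone"
    then obtain q where q: "\<And>n::nat. q n \<in> ?Q" and lim: "q \<longlonglongrightarrow> y" and y: "y \<in> pos_def_cone"
      unfolding islimpt_sequential by blast
    from q have "\<forall>n. \<exists>s. s \<in> pos_def_cone \<and> q n = s ** s"
      by auto
    then obtain s where s: "\<And>n. s n \<in> pos_def_cone" "\<And>n. q n = s n ** s n"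
      unfolding choice_iff by auto
    have "(\<lambda>n. s n ** s n) \<longlonglongrightarrow> y"
      using lim by (simp flip: s(2))
    from pos_def_square_limit[OF s(1) this y] show "y \<in> ?Q"
      by auto
  qed
  moreover have "connected (pos_def_cone :: (real^'n^'n) set)"
    by (rule convex_connected[OF convex_pos_def_cone])
  ultimately have "?Q = {} \<or> ?Q = pos_def_cone"
    unfolding connected_clopen by blast
  then show ?thesis
    using pos_def_mat_1 by auto
qed

lemma ex1_square_root_pos_def:
  assumes "y \<in> pos_def_cone"
  shows "\<exists>!s. s \<in> pos_def_cone \<and> s ** s = (y :: real^'n^'n)"
proof -
  have "y \<in> (\<lambda>s. s ** s) ` pos_def_cone"
    using assms by (simp add: square_image_pos_def)
  then obtain s where s: "s \<in> pos_def_cone" "s ** s = y"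
    by auto
  show ?thesis
  proof (rule ex1I[of _ s])
    show "t = s" if "t \<in> pos_def_cone \<and> t ** t = y" for t
      using inj_onD[OF inj_on_square_pos_def, of t s] that s by simp
  qed (use s in simp)
qed

lemma
  assumes "y \<in> pos_def_cone"
  shows msqrt_pos_def: "msqrt y \<in> pos_def_cone" and msqrt_square: "msqrt y ** msqrt y = y"
  using theI'[OF ex1_square_root_pos_def[OF assms]] by (simp_all add: msqrt_def)

lemma msqrt_of_square:
  assumes "s \<in> pos_def_cone"
  shows "msqrt (s ** s) = s"
  using inj_onD[OF inj_on_square_pos_def, of "msqrt (s ** s)" s] assms
    msqrt_pos_def[OF pos_def_square[OF assms]] msqrt_square[OF pos_def_square[OF assms]]
  by simp

text \<open>The inverse of a continuous open bijection is continuous. This is the source of Borel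
  measurability for everything built from \<open>msqrt\<close>.\<close>

lemma continuous_on_msqrt: "continuous_on (pos_def_cone :: (real^'n^'n) set) msqrt"
proof (rule continuous_on_inverse_open_map[where f = "\<lambda>s. s ** s"])
  show "continuous_on pos_def_cone (\<lambda>s::real^'n^'n. s ** s)"
    by (intro continuous_intros)
qed (simp_all add: square_image_pos_def msqrt_of_square openin_square_pos_def)

text \<open>The determinant is the square of the determinant of the root, and it is nonzero by
  invertibility.\<close>

lemma pos_def_det_pos:
  assumes "x \<in> (pos_def_cone :: (real^'n^'n) set)"
  shows "det x > 0"
proof -
  have "det x = det (msqrt x) * det (msqrt x)"
    by (metis assms det_mul msqrt_square)
  moreover have "det x \<noteq> 0"
    using pos_def_invertible[OF assms] by (simp add: invertible_det_nz)
  ultimately show ?thesis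
    by (metis not_real_square_gt_zero mult_zero_left)
qed

subsection \<open>Lebesgue measure on symmetric matrices under congruence\<close>

text \<open>Preimages of boxes are boxes, so the rescaled image measure agrees with the product
  measure on boxes, which determine it. The case \<open>t = 0\<close> serves diagonal matrices, the
  case \<open>k = 1\<close> the translations inside a shear.\<close>

lemma nn_integral_PiM_affine:
  fixes k t :: "'i \<Rightarrow> real"
  assumes I: "finite I" and k: "\<And>i. i \<in> I \<Longrightarrow> k i \<noteq> 0"
    and F[measurable]: "F \<in> borel_measurable (\<Pi>\<^sub>M i\<in>I. lborel)"
  shows "(\<integral>\<^sup>+f. F f \<partial>(\<Pi>\<^sub>M i\<in>I. lborel)) =
    ennreal (\<Prod>i\<in>I. \<bar>k i\<bar>) * (\<integral>\<^sup>+f. F (\<lambda>i\<in>I. t i + k i * f i) \<partial>(\<Pi>\<^sub>M i\<in>I. lborel))"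
proof -
  interpret product_sigma_finite "\<lambda>_::'i. lborel :: real measure" ..
  let ?P = "\<Pi>\<^sub>M i\<in>I. lborel :: real measure" and ?T = "\<lambda>f. \<lambda>i\<in>I. t i + k i * f i"
  have T[measurable]: "?T \<in> ?P \<rightarrow>\<^sub>M ?P"
    by (intro measurable_restrict) measurable
  have "density (distr ?P ?P ?T) (\<lambda>_. ennreal (\<Prod>i\<in>I. \<bar>k i\<bar>)) = ?P"
  proof (rule PiM_eqI[OF I])
    fix A assume A: "\<And>i. i \<in> I \<Longrightarrow> A i \<in> sets (lborel :: real measure)"
    have PA: "Pi\<^sub>E I A \<in> sets ?P"
      using A I by (intro sets_PiM_I_finite) auto
    have pre: "?T -` Pi\<^sub>E I A \<inter> space ?P = Pi\<^sub>E I (\<lambda>i. (\<lambda>x. t i + k i * x) -` A i)"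
      by (auto simp: space_PiM PiE_iff)
    have vim: "(\<lambda>x. t i + k i * x) -` A i \<in> sets borel" if "i \<in> I" for i
    proof (rule measurable_sets_borel)
      show "A i \<in> sets borel"
        using A[OF that] by simp
    qed measurable
    have one: "emeasure lborel (A i) = ennreal \<bar>k i\<bar> * emeasure lborel ((\<lambda>x. t i + k i * x) -` A i)"
      if "i \<in> I" for i
    proof -
      have [measurable]: "A i \<in> sets borel"
        using A[OF that] by simp
      have "emeasure lborel (A i) = (\<integral>\<^sup>+x. indicator (A i) x \<partial>lborel)"
        by simp
      also have "\<dots> = ennreal \<bar>k i\<bar> * (\<integral>\<^sup>+x. indicator (A i) (t i + k i * x) \<partial>lborel)"
        by (rule nn_integral_real_affine) (use k[OF that] in auto)
      also have "(\<integral>\<^sup>+x. indicator (A i) (t i + k i * x) \<partial>lborel)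
          = (\<integral>\<^sup>+x. indicator ((\<lambda>x. t i + k i * x) -` A i) x \<partial>lborel)"
        by (simp add: indicator_vimage)
      also have "\<dots> = emeasure lborel ((\<lambda>x. t i + k i * x) -` A i)"
        using vim[OF that] by (intro nn_integral_indicator) simp
      finally show ?thesis .
    qed
    have "emeasure (density (distr ?P ?P ?T) (\<lambda>_. ennreal (\<Prod>i\<in>I. \<bar>k i\<bar>))) (Pi\<^sub>E I A)
      = ennreal (\<Prod>i\<in>I. \<bar>k i\<bar>) * emeasure ?P (Pi\<^sub>E I (\<lambda>i. (\<lambda>x. t i + k i * x) -` A i))"
      using PA by (simp add: emeasure_density_const emeasure_distr pre)
    also have "emeasure ?P (Pi\<^sub>E I (\<lambda>i. (\<lambda>x. t i + k i * x) -` A i))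
      = (\<Prod>i\<in>I. emeasure lborel ((\<lambda>x. t i + k i * x) -` A i))"
      using vim by (intro emeasure_PiM I) simp
    also have "ennreal (\<Prod>i\<in>I. \<bar>k i\<bar>) * \<dots> = (\<Prod>i\<in>I. ennreal \<bar>k i\<bar> * emeasure lborel ((\<lambda>x. t i + k i * x) -` A i))"
      by (simp add: prod.distrib prod_ennreal)
    also have "\<dots> = (\<Prod>i\<in>I. emeasure lborel (A i))"
      by (intro prod.cong refl one[symmetric])
    finally show "emeasure (density (distr ?P ?P ?T) (\<lambda>_. ennreal (\<Prod>i\<in>I. \<bar>k i\<bar>))) (Pi\<^sub>E I A)
      = (\<Prod>i\<in>I. emeasure lborel (A i))" .
  qed simp
  then have "(\<integral>\<^sup>+f. F f \<partial>?P) = (\<integral>\<^sup>+f. F f \<partial>density (distr ?P ?P ?T) (\<lambda>_. ennreal (\<Prod>i\<in>I. \<bar>k i\<bar>)))"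
    by simp
  also have "\<dots> = (\<integral>\<^sup>+f. ennreal (\<Prod>i\<in>I. \<bar>k i\<bar>) * F (?T f) \<partial>?P)"
    by (subst nn_integral_density) (simp_all add: nn_integral_distr)
  also have "\<dots> = ennreal (\<Prod>i\<in>I. \<bar>k i\<bar>) * (\<integral>\<^sup>+f. F (?T f) \<partial>?P)"
    by (rule nn_integral_cmult) measurable
  finally show ?thesis .
qed

lemma nn_integral_PiM_permute:
  fixes p :: "'i \<Rightarrow> 'i"
  assumes I: "finite I" and p: "bij_betw p I I"
    and F[measurable]: "F \<in> borel_measurable (\<Pi>\<^sub>M i\<in>I. lborel :: real measure)"
  shows "(\<integral>\<^sup>+f. F f \<partial>(\<Pi>\<^sub>M i\<in>I. lborel)) = (\<integral>\<^sup>+f. F (\<lambda>i\<in>I. f (p i)) \<partial>(\<Pi>\<^sub>M i\<in>I. lborel))"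
proof -
  interpret product_sigma_finite "\<lambda>_::'i. lborel :: real measure" ..
  let ?P = "\<Pi>\<^sub>M i\<in>I. lborel :: real measure" and ?T = "\<lambda>f. \<lambda>i\<in>I. f (p i) :: real"
  have pI: "p i \<in> I" if "i \<in> I" for i
    using p that by (auto simp: bij_betw_def)
  have T[measurable]: "?T \<in> ?P \<rightarrow>\<^sub>M ?P"
    using pI by (intro measurable_restrict) (auto intro: measurable_component_singleton)
  have "distr ?P ?P ?T = ?P"
  proof (rule PiM_eqI[OF I])
    fix A assume A: "\<And>i. i \<in> I \<Longrightarrow> A i \<in> sets (lborel :: real measure)"
    have PA: "Pi\<^sub>E I A \<in> sets ?P"
      using A I by (intro sets_PiM_I_finite) auto
    define q where "q = inv_into I p"
    have q: "bij_betw q I I"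
      unfolding q_def by (rule bij_betw_inv_into[OF p])
    have qI: "q i \<in> I" if "i \<in> I" for i
      using q that by (auto simp: bij_betw_def)
    have qp: "q (p i) = i" "p (q i) = i" if "i \<in> I" for i
      using p that by (auto simp: q_def bij_betw_def f_inv_into_f)
    have pre: "?T -` Pi\<^sub>E I A \<inter> space ?P = Pi\<^sub>E I (\<lambda>i. A (q i))"
    proof -
      have "(\<forall>i\<in>I. f (p i) \<in> A i) \<longleftrightarrow> (\<forall>i\<in>I. f i \<in> A (q i))" for f
        using pI qI qp by metis
      then show ?thesis
        by (auto simp: space_PiM PiE_iff)
    qed
    have "emeasure (distr ?P ?P ?T) (Pi\<^sub>E I A) = emeasure ?P (Pi\<^sub>E I (\<lambda>i. A (q i)))"
      using PA by (simp add: emeasure_distr pre)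
    also have "\<dots> = (\<Prod>i\<in>I. emeasure lborel (A (q i)))"
      using A qI by (intro emeasure_PiM I) auto
    also have "\<dots> = (\<Prod>i\<in>I. emeasure lborel (A i))"
      by (rule prod.reindex_bij_betw[OF q])
    finally show "emeasure (distr ?P ?P ?T) (Pi\<^sub>E I A) = (\<Prod>i\<in>I. emeasure lborel (A i))" .
  qed simp
  then have "(\<integral>\<^sup>+f. F f \<partial>?P) = (\<integral>\<^sup>+f. F f \<partial>distr ?P ?P ?T)"
    by simp
  also have "\<dots> = (\<integral>\<^sup>+f. F (?T f) \<partial>?P)"
    by (simp add: nn_integral_distr)
  finally show ?thesis .
qed

text \<open>Once the coordinates outside \<open>J\<close> are fixed, \<open>h\<close> is constant
  and the map is a translation of the coordinates in \<open>J\<close>; Fubini and translation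
  invariance finish.\<close>

lemma nn_integral_PiM_shear:
  fixes h :: "('i \<Rightarrow> real) \<Rightarrow> 'i \<Rightarrow> real"
  assumes I: "finite I" and J: "J \<subseteq> I"
    and h[measurable]: "\<And>j. j \<in> J \<Longrightarrow> (\<lambda>f. h f j) \<in> borel_measurable (\<Pi>\<^sub>M i\<in>I. lborel)"
    and indep: "\<And>f g j. j \<in> J \<Longrightarrow> (\<And>i. i \<in> I - J \<Longrightarrow> f i = g i) \<Longrightarrow> h f j = h g j"
    and F[measurable]: "F \<in> borel_measurable (\<Pi>\<^sub>M i\<in>I. lborel)"
  shows "(\<integral>\<^sup>+f. F f \<partial>(\<Pi>\<^sub>M i\<in>I. lborel)) =
    (\<integral>\<^sup>+f. F (\<lambda>i\<in>I. if i \<in> J then h f i + f i else f i) \<partial>(\<Pi>\<^sub>M i\<in>I. lborel))"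
proof -
  interpret product_sigma_finite "\<lambda>_::'i. lborel :: real measure" ..
  let ?K = "I - J"
  have fin: "finite ?K" "finite J" and KJ: "?K \<inter> J = {}" and U: "?K \<union> J = I"
    using I J by (auto intro: finite_subset)
  let ?T = "\<lambda>f. \<lambda>i\<in>I. if i \<in> J then h f i + f i else f i"
  have T[measurable]: "?T \<in> (\<Pi>\<^sub>M i\<in>I. lborel :: real measure) \<rightarrow>\<^sub>M (\<Pi>\<^sub>M i\<in>I. lborel :: real measure)"
  proof (intro measurable_restrict)
    fix i assume "i \<in> I"
    then show "(\<lambda>f. if i \<in> J then h f i + f i else f i) \<in> (\<Pi>\<^sub>M i\<in>I. lborel :: real measure) \<rightarrow>\<^sub>M lborel"
      by (cases "i \<in> J") simp_all
  qed
  have F'[measurable]: "F \<in> borel_measurable (Pi\<^sub>M (?K \<union> J) (\<lambda>i. lborel))"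
    using F U by simp
  have FT: "(\<lambda>f. F (?T f)) \<in> borel_measurable (Pi\<^sub>M (?K \<union> J) (\<lambda>i. lborel))"
    unfolding U by measurable
  have inner: "(\<integral>\<^sup>+y. F (merge ?K J (x, y)) \<partial>(\<Pi>\<^sub>M i\<in>J. lborel)) =
      (\<integral>\<^sup>+y. F (?T (merge ?K J (x, y))) \<partial>(\<Pi>\<^sub>M i\<in>J. lborel))"
    if x: "x \<in> space (\<Pi>\<^sub>M i\<in>?K. lborel :: real measure)" for x
  proof -
    \<comment> \<open>\<open>h\<close> ignores the coordinates in \<open>J\<close>, so they may be
      filled with 0.\<close>
    define t where "t = h (merge ?K J (x, \<lambda>_. 0))"
    have [measurable]: "(\<lambda>y. F (merge ?K J (x, y))) \<in> borel_measurable (\<Pi>\<^sub>M i\<in>J. lborel)"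
      using x by measurable
    have shift: "merge ?K J (x, \<lambda>j\<in>J. t j + 1 * y j) = ?T (merge ?K J (x, y))" for y
    proof -
      have "h (merge ?K J (x, y)) j = t j" if "j \<in> J" for j
        unfolding t_def using that by (intro indep) (auto simp: merge_def)
      then show ?thesis
        using U by (auto simp: merge_def restrict_def fun_eq_iff)
    qed
    have "(\<integral>\<^sup>+y. F (merge ?K J (x, y)) \<partial>(\<Pi>\<^sub>M i\<in>J. lborel)) =
        (\<integral>\<^sup>+y. F (merge ?K J (x, \<lambda>j\<in>J. t j + 1 * y j)) \<partial>(\<Pi>\<^sub>M i\<in>J. lborel))"
      by (subst nn_integral_PiM_affine[where k = "\<lambda>_. 1" and t = t]) (use fin in auto)
    then show ?thesis
      by (simp only: shift)
  qed
  have "(\<integral>\<^sup>+f. F f \<partial>(\<Pi>\<^sub>M i\<in>?K \<union> J. lborel)) = (\<integral>\<^sup>+f. F (?T f) \<partial>(\<Pi>\<^sub>M i\<in>?K \<union> J. lborel))"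
    unfolding product_nn_integral_fold[OF KJ fin F'] product_nn_integral_fold[OF KJ fin FT]
    by (intro nn_integral_cong inner)
  then show ?thesis
    by (simp only: U)
qed

section \<open>Integration over the free entries\<close>

lemma entry_in_entry_indices [simp]: "{i, j} \<in> entry_indices"
  by (auto simp: entry_indices_def)

lemma singleton_in_entry_indices [simp]: "{i} \<in> entry_indices"
  using entry_in_entry_indices[of i i] by simp

lemma sym_of_entries_nth [simp]: "sym_of_entries f $ i $ j = f {i, j}"
  by (simp add: sym_of_entries_def)

lemma nn_integral_sym_lborel:
  assumes [measurable]: "F \<in> borel_measurable borel"
  shows "(\<integral>\<^sup>+x. F x \<partial>(sym_lborel :: (real^'n^'n) measure)) =
    (\<integral>\<^sup>+f. F (sym_of_entries f) \<partial>(\<Pi>\<^sub>M s\<in>entry_indices. lborel))"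
  unfolding sym_lborel_def by (simp add: nn_integral_distr)

text \<open>Entrywise cubes exhaust the space, and \<open>sym_of_entries\<close> pulls them back to
  product boxes of finite measure. The result licenses the exchange of integrals over
  \<open>x\<close> and \<open>u\<close>.\<close>

lemma sigma_finite_sym_lborel: "sigma_finite_measure (sym_lborel :: (real^'n^'n) measure)"
proof
  interpret product_sigma_finite "\<lambda>_::'n set. lborel :: real measure" ..
  define B :: "nat \<Rightarrow> (real^'n^'n) set" where "B n = {x. \<forall>i j. \<bar>x $ i $ j\<bar> \<le> real n}" for n
  let ?P = "\<Pi>\<^sub>M s\<in>(entry_indices :: 'n set set). lborel :: real measure"
  have B: "B n \<in> sets borel" for n
    unfolding B_def Collect_all_eq
    by (intro borel_closed closed_INT ballI closed_Collect_le continuous_intros)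
  have "emeasure sym_lborel (B n) \<noteq> \<infinity>" for n
  proof -
    have "(\<forall>s\<in>entry_indices. f s \<in> {- real n..real n}) \<longleftrightarrow> (\<forall>i j. \<bar>f {i, j}\<bar> \<le> real n)" for f :: "'n set \<Rightarrow> real"
      unfolding entry_indices_def by (auto simp: abs_le_iff minus_le_iff)
    then have "sym_of_entries -` B n \<inter> space ?P = Pi\<^sub>E entry_indices (\<lambda>_. {- real n..real n})"
      by (auto simp: B_def space_PiM PiE_def Pi_def)
    then have "emeasure sym_lborel (B n) = (\<Prod>s\<in>(entry_indices :: 'n set set). emeasure lborel {- real n..real n})"
      using B by (simp add: sym_lborel_def emeasure_distr emeasure_PiM)
    then show ?thesis
      by (simp add: ennreal_power)
  qed
  moreover have "(\<Union>n. B n) = space sym_lborel"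
  proof -
    have "\<exists>n. x \<in> B n" for x
    proof -
      obtain n where "norm x \<le> real n"
        using real_arch_simple by blast
      then have "\<bar>x $ i $ j\<bar> \<le> real n" for i j
        using component_le_norm_cart[of "x $ i" j] Finite_Cartesian_Product.norm_nth_le[of x i] by linarith
      then show ?thesis
        by (auto simp: B_def)
    qed
    then show ?thesis
      by (auto simp: sym_lborel_def)
  qed
  ultimately show "\<exists>A. countable A \<and> A \<subseteq> sets sym_lborel \<and> \<Union> A = space sym_lborel
      \<and> (\<forall>a\<in>A. emeasure (sym_lborel :: (real^'n^'n) measure) a \<noteq> \<infinity>)"
    using B by (intro exI[of _ "range B"]) (auto simp: sets_sym_lborel)
qed

section \<open>The Jacobian of congruence\<close>

text \<open>This is the factor \<open>d i * d j\<close> that congruence by the diagonal matrix of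
  \<open>d\<close> applies to the entry \<open>{i, j}\<close>, expressed through the set alone. For
  \<open>i = j\<close> the pair collapses to a singleton, hence the square.\<close>

definition entry_weight :: "('n \<Rightarrow> real) \<Rightarrow> 'n set \<Rightarrow> real" where
  "entry_weight d s = (if card s = 1 then (\<Prod>i\<in>s. d i)\<^sup>2 else (\<Prod>i\<in>s. d i))"

lemma entry_weight_pair: "entry_weight d {i, j} = d i * d j"
  by (cases "i = j") (auto simp: entry_weight_def power2_eq_square)

text \<open>Each \<open>d i\<close> occurs once for every pair with another index,
  \<open>card S - 1\<close> times in all, and twice for \<open>{i}\<close>. The total
  \<open>card S + 1\<close> is the origin of the Jacobian exponent.\<close>

lemma prod_entry_weight_on:
  assumes "finite S"
  shows "(\<Prod>s\<in>(\<lambda>(i, j). {i, j}) ` (S \<times> S). entry_weight d s) = (\<Prod>i\<in>S. d i) ^ (card S + 1)"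
  using assms
proof induction
  case (insert a S)
  let ?E = "\<lambda>S. (\<lambda>(i, j). {i, j}) ` (S \<times> S)" and ?N = "(\<lambda>j. {a, j}) ` insert a S"
  have split: "?E (insert a S) = ?E S \<union> ?N"
    by (auto simp: image_iff insert_commute)
  have inj: "inj_on (\<lambda>j. {a, j}) (insert a S)"
    by (auto simp: inj_on_def doubleton_eq_iff)
  have "(\<Prod>s\<in>?N. entry_weight d s) = (\<Prod>j\<in>insert a S. d a * d j)"
    by (subst prod.reindex[OF inj]) (simp add: entry_weight_pair)
  \<comment> \<open>Of the factors \<open>d a\<close>, \<open>card S + 1\<close> come from the
    constant factor and one more from \<open>j = a\<close>.\<close>
  also have "\<dots> = d a ^ (card S + 2) * (\<Prod>j\<in>S. d j)"
    using insert.hyps by (simp add: prod.distrib)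
  finally have N: "(\<Prod>s\<in>?N. entry_weight d s) = d a ^ (card S + 2) * (\<Prod>j\<in>S. d j)" .
  have "?E S \<inter> ?N = {}"
    using insert.hyps by (auto simp: doubleton_eq_iff)
  then have "(\<Prod>s\<in>?E (insert a S). entry_weight d s) = (\<Prod>s\<in>?E S. entry_weight d s) * (\<Prod>s\<in>?N. entry_weight d s)"
    unfolding split using insert.hyps by (intro prod.union_disjoint) auto
  also have "\<dots> = (\<Prod>i\<in>S. d i) ^ (card S + 1) * (d a ^ (card S + 2) * (\<Prod>j\<in>S. d j))"
    by (simp only: insert.IH N)
  finally have "(\<Prod>s\<in>?E (insert a S). entry_weight d s) = \<dots>" .
  then show ?case
    using insert.hyps by (simp add: power_mult_distrib)
qed simp

lemma prod_entry_weight: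
  "(\<Prod>s\<in>entry_indices. entry_weight d s) = (\<Prod>i\<in>UNIV. d i) ^ (CARD('n) + 1)"
  for d :: "'n::finite \<Rightarrow> real"
proof -
  have "entry_indices = (\<lambda>(i, j). {i, j}) ` (UNIV \<times> (UNIV :: 'n set))"
    by (auto simp: entry_indices_def)
  then show ?thesis
    using prod_entry_weight_on[of "UNIV :: 'n set" d] by simp
qed

lemma measurable_congruence [measurable]:
  fixes A B :: "real^'n^'n"
  shows "(\<lambda>x. A ** x ** B) \<in> borel \<rightarrow>\<^sub>M borel"
  unfolding matrix_matrix_mult_def by (intro borel_measurable_continuous_onI continuous_intros)

lemma sym_congruence_component:
  fixes A x :: "real^'n^'n"
  shows "(A ** x ** transpose A) $ i $ j = (\<Sum>k\<in>UNIV. (\<Sum>l\<in>UNIV. A $ i $ l * x $ l $ k) * A $ j $ k)"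
  by (simp add: matrix_matrix_mult_def transpose_def)

text \<open>Nonsingularity is a premise inside the predicate, so that it holds trivially for
  singular matrices; the induction over elementary factors has a case for matrices with a zero row.
  Quantifying over \<open>F\<close> inside lets a product be handled by applying the second factor
  to the already transformed integrand.\<close>

definition congruence_scales :: "real^'n^'n \<Rightarrow> bool" where
  "congruence_scales A \<longleftrightarrow> (\<forall>F\<in>borel_measurable borel. det A \<noteq> 0 \<longrightarrow>
     (\<integral>\<^sup>+x. F x \<partial>sym_lborel) =
     ennreal (\<bar>det A\<bar> ^ (CARD('n) + 1)) * (\<integral>\<^sup>+x. F (A ** x ** transpose A) \<partial>sym_lborel))"

lemma congruence_scales_mult:
  fixes A B :: "real^'n^'n"
  assumes A: "congruence_scales A" and B: "congruence_scales B"
  shows "congruence_scales (A ** B)"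
  unfolding congruence_scales_def
proof (intro ballI impI)
  fix F :: "real^'n^'n \<Rightarrow> ennreal"
  assume F[measurable]: "F \<in> borel_measurable borel" and "det (A ** B) \<noteq> 0"
  then have nz: "det A \<noteq> 0" "det B \<noteq> 0"
    by (auto simp: det_mul)
  have FA: "(\<lambda>x. F (A ** x ** transpose A)) \<in> borel_measurable borel"
    by measurable
  have "(\<integral>\<^sup>+x. F x \<partial>sym_lborel) =
      ennreal (\<bar>det A\<bar> ^ (CARD('n) + 1)) * (\<integral>\<^sup>+x. F (A ** x ** transpose A) \<partial>sym_lborel)"
    using A F nz unfolding congruence_scales_def by blast
  also have "(\<integral>\<^sup>+x. F (A ** x ** transpose A) \<partial>sym_lborel) =
      ennreal (\<bar>det B\<bar> ^ (CARD('n) + 1)) * (\<integral>\<^sup>+x. F (A ** (B ** x ** transpose B) ** transpose A) \<partial>sym_lborel)"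
    using B FA nz unfolding congruence_scales_def by blast
  finally show "(\<integral>\<^sup>+x. F x \<partial>sym_lborel) = ennreal (\<bar>det (A ** B)\<bar> ^ (CARD('n) + 1)) *
      (\<integral>\<^sup>+x. F (A ** B ** x ** transpose (A ** B)) \<partial>sym_lborel)"
    by (simp add: det_mul abs_mult power_mult_distrib ennreal_mult matrix_transpose_mul matrix_mul_assoc ac_simps)
qed

text \<open>Each free entry is rescaled separately, so the Jacobian is the product of the entry
  weights.\<close>

lemma congruence_scales_diagonal:
  fixes A :: "real^'n^'n"
  assumes diag: "\<And>i j. i \<noteq> j \<Longrightarrow> A $ i $ j = 0"
  shows "congruence_scales A"
  unfolding congruence_scales_def
proof (intro ballI impI)
  fix F :: "real^'n^'n \<Rightarrow> ennreal"
  assume F[measurable]: "F \<in> borel_measurable borel" and nz: "det A \<noteq> 0"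
  define d where "d i = A $ i $ i" for i
  have A: "A $ i $ j = (if i = j then d i else 0)" for i j
    using diag by (simp add: d_def)
  have det: "det A = (\<Prod>i\<in>UNIV. d i)"
    using det_diagonal[of A] diag by (simp add: d_def)
  have w: "entry_weight d s \<noteq> 0" if "s \<in> entry_indices" for s
    using nz that unfolding det by (auto simp: entry_indices_def entry_weight_pair)
  have act: "sym_of_entries (\<lambda>s\<in>entry_indices. 0 + entry_weight d s * f s)
      = A ** sym_of_entries f ** transpose A" for f
    by (simp add: vec_eq_iff sym_congruence_component A entry_weight_pair
        if_distrib[of "\<lambda>x. x * _"] if_distrib[of "\<lambda>x. _ * x"] cong: if_cong)
  have "(\<Prod>s\<in>entry_indices. \<bar>entry_weight d s\<bar>) = \<bar>det A\<bar> ^ (CARD('n) + 1)"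
    unfolding det by (subst abs_prod[symmetric]) (simp only: prod_entry_weight power_abs)
  then show "(\<integral>\<^sup>+x. F x \<partial>sym_lborel) = ennreal (\<bar>det A\<bar> ^ (CARD('n) + 1)) *
      (\<integral>\<^sup>+x. F (A ** x ** transpose A) \<partial>sym_lborel)"
    using nn_integral_PiM_affine[of entry_indices "entry_weight d" "\<lambda>f. F (sym_of_entries f)" "\<lambda>_. 0"] w
    by (simp add: nn_integral_sym_lborel flip: act)
qed

text \<open>A transposition of indices acts on the unordered pairs by a bijection, so the free
  entries are merely permuted, and the determinant is 1 in absolute value.\<close>

lemma congruence_scales_swap:
  fixes m n :: "'n::finite"
  assumes "m \<noteq> n"
  shows "congruence_scales (\<chi> i j. mat 1 $ i $ Transposition.transpose m n j :: real^'n^'n)" (is "congruence_scales ?A")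
  unfolding congruence_scales_def
proof (intro ballI impI)
  fix F :: "real^'n^'n \<Rightarrow> ennreal"
  assume F[measurable]: "F \<in> borel_measurable borel"
  let ?\<sigma> = "Transposition.transpose m n"
  define A :: "real^'n^'n" where "A = ?A"
  have det: "\<bar>det A\<bar> = 1"
    unfolding A_def by (subst det_permute_columns) (auto simp: permutes_swap_id sign_def)
  have A: "A $ i $ j = (if j = ?\<sigma> i then 1 else 0)" for i j
    by (auto simp: A_def mat_def)
  have act: "sym_of_entries (\<lambda>s\<in>entry_indices. f (?\<sigma> ` s)) = A ** sym_of_entries f ** transpose A" for f
    by (simp add: vec_eq_iff sym_congruence_component A
        if_distrib[of "\<lambda>x. x * _"] if_distrib[of "\<lambda>x. _ * x"] cong: if_cong)
  have "?\<sigma> ` ?\<sigma> ` s = s" for s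
    by (simp add: image_comp)
  then have "bij_betw ((`) ?\<sigma>) entry_indices entry_indices"
    by (intro bij_betw_byWitness[where f' = "(`) ?\<sigma>"]) (auto simp: entry_indices_def)
  then have "(\<integral>\<^sup>+x. F x \<partial>sym_lborel) = ennreal (\<bar>det A\<bar> ^ (CARD('n) + 1)) *
      (\<integral>\<^sup>+x. F (A ** x ** transpose A) \<partial>sym_lborel)"
    using nn_integral_PiM_permute[of entry_indices "(`) ?\<sigma>" "\<lambda>f. F (sym_of_entries f)"]
    by (simp add: nn_integral_sym_lborel act det)
  then show "(\<integral>\<^sup>+x. F x \<partial>sym_lborel) = ennreal (\<bar>det ?A\<bar> ^ (CARD('n) + 1)) *
      (\<integral>\<^sup>+x. F (?A ** x ** transpose ?A) \<partial>sym_lborel)"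
    by (simp only: A_def)
qed

text \<open>Congruence adds row \<open>n\<close> to row \<open>m\<close> and column \<open>n\<close>
  to column \<open>m\<close>: \<open>f {m, j}\<close> with \<open>j \<noteq> m\<close> gains
  \<open>f {n, j}\<close>, while \<open>f {m}\<close> gains \<open>2 * f {m, n} + f {n}\<close>. The
  latter increment involves \<open>{m, n}\<close>, itself one of the altered entries, so the map is
  split into two shears, each with increments depending only on entries it leaves fixed. Both
  preserve volume, matching \<open>det A = 1\<close>.\<close>

lemma congruence_scales_shear:
  fixes m n :: "'n::finite"
  assumes mn: "m \<noteq> n"
  shows "congruence_scales (\<chi> i j. of_bool (i = m \<and> j = n \<or> i = j) :: real^'n^'n)" (is "congruence_scales ?A")
  unfolding congruence_scales_def
proof (intro ballI impI)
  fix F :: "real^'n^'n \<Rightarrow> ennreal"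
  assume F[measurable]: "F \<in> borel_measurable borel"
  define A :: "real^'n^'n" where "A = ?A"
  have "A = (\<chi> k. if k = m then row m (mat 1) + 1 *s row n (mat 1) else row k (mat 1))"
    using mn by (auto simp: A_def vec_eq_iff row_def mat_def)
  then have det: "det A = 1"
    by (simp only: det_row_operation[OF mn] det_I)
  let ?P = "\<Pi>\<^sub>M s\<in>(entry_indices :: 'n set set). lborel :: real measure"
  define J where "J = {s \<in> entry_indices. m \<in> s \<and> s \<noteq> {m}}"
  \<comment> \<open>The index \<open>m\<close> is replaced by \<open>n\<close>; for
    \<open>s = {m, n}\<close> this yields the diagonal index \<open>{n}\<close>.\<close>
  define h where "h f s = (f (insert n (s - {m})) :: real)" for f and s
  define T where "T f = (\<lambda>s\<in>entry_indices. if s \<in> J then h f s + f s else f s)" for f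
  \<comment> \<open>\<open>T'\<close> acts before \<open>T\<close>, so the diagonal entry is updated
    with the old value of \<open>f {m, n}\<close>; \<open>T\<close> then leaves \<open>{m}\<close>
    alone.\<close>
  define T' where "T' f = (\<lambda>s\<in>entry_indices. if s \<in> {{m}} then 2 * f {m, n} + f {n} + f s else f s :: real)" for f
  have hJ: "insert n (s - {m}) \<in> entry_indices" "m \<notin> insert n (s - {m})" if "s \<in> J" for s
  proof -
    from that obtain j where "s = {m, j}" "j \<noteq> m"
      by (auto simp: J_def entry_indices_def)
    then show "insert n (s - {m}) \<in> entry_indices" "m \<notin> insert n (s - {m})"
      using mn by (auto simp: insert_Diff_if)
  qed
  have h: "(\<lambda>f. h f s) \<in> borel_measurable ?P" if "s \<in> J" for s
    using measurable_component_singleton[OF hJ(1)[OF that], of "\<lambda>_. lborel"] by (simp add: h_def)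
  have T: "T \<in> ?P \<rightarrow>\<^sub>M ?P"
    unfolding T_def
  proof (intro measurable_restrict)
    fix s :: "'n set" assume "s \<in> entry_indices"
    then show "(\<lambda>f. if s \<in> J then h f s + f s else f s) \<in> ?P \<rightarrow>\<^sub>M lborel"
      using h by (cases "s \<in> J") auto
  qed
  have act: "sym_of_entries (T (T' f)) = A ** sym_of_entries f ** transpose A" for f
  proof -
    have A: "A $ i $ j = (if j = i then 1 else 0) + (if j = n then if i = m then 1 else 0 else 0)" for i j
      using mn by (auto simp: A_def)
    have "sym_of_entries (T (T' f)) $ i $ j = (A ** sym_of_entries f ** transpose A) $ i $ j" for i j
    proof -
      have "(A ** sym_of_entries f ** transpose A) $ i $ j =
          f {i, j} + (if i = m then f {n, j} else 0) + (if j = m then f {i, n} else 0)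
          + (if i = m \<and> j = m then f {n} else 0)"
        by (simp add: sym_congruence_component A distrib_left distrib_right sum.distrib
            if_distrib[of "\<lambda>x. x * _"] if_distrib[of "\<lambda>x. _ * x"] cong: if_cong)
      also have "\<dots> = T (T' f) {i, j}"
      proof -
        have T'1: "T' f {k, l} = f {k, l}" if "k \<noteq> m \<or> l \<noteq> m" for k l
          using that by (auto simp: T'_def)
        have T'2: "T' f {m} = 2 * f {m, n} + f {n} + f {m}"
          by (simp add: T'_def)
        have T1: "T g {m, k} = g {n, k} + g {m, k}" if "k \<noteq> m" for g k
        proof -
          have "{m, k} - {m} = {k}"
            using that by auto
          then show ?thesis
            using that by (auto simp: T_def J_def h_def)
        qed
        have T2: "T g {k, l} = g {k, l}" if "k \<noteq> m \<and> l \<noteq> m \<or> k = l" for g k l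
          using that by (auto simp: T_def J_def)
        consider "i = m" "j \<noteq> m" | "i \<noteq> m" "j = m" | "i = m" "j = m" | "i \<noteq> m" "j \<noteq> m"
          by blast
        then show ?thesis
        proof cases
          case 1
          then show ?thesis
            using T1[of j] T'1[of n j] T'1[of m j] mn by simp
        next
          case 2
          then show ?thesis
            using T1[of i] T'1[of n i] T'1[of m i] mn by (simp add: insert_commute[of i])
        next
          case 3
          then show ?thesis
            using T2[of m m] T'2 by (simp add: insert_commute[of n])
        next
          case 4
          then show ?thesis
            using T2[of i j] T'1[of i j] by simp
        qed
      qed
      finally show ?thesis
        by simp
    qed
    then show ?thesis
      by (simp add: vec_eq_iff)
  qed
  have "(\<integral>\<^sup>+f. F (sym_of_entries f) \<partial>?P) = (\<integral>\<^sup>+f. F (sym_of_entries (T f)) \<partial>?P)"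
    unfolding T_def
  proof (rule nn_integral_PiM_shear)
    show "h f s = h g s" if "s \<in> J" "\<And>s. s \<in> entry_indices - J \<Longrightarrow> f s = g s" for f g s
      using that(2)[of "insert n (s - {m})"] hJ[OF that(1)] by (auto simp: h_def J_def)
  qed (use h in \<open>auto simp: J_def\<close>)
  also have "\<dots> = (\<integral>\<^sup>+f. F (sym_of_entries (T (T' f))) \<partial>?P)"
    unfolding T'_def
  proof (rule nn_integral_PiM_shear)
    show "(\<lambda>f. 2 * f {m, n} + f {n}) \<in> borel_measurable ?P"
      using measurable_component_singleton[of "{m, n}" entry_indices "\<lambda>_. lborel"]
        measurable_component_singleton[of "{n}" entry_indices "\<lambda>_. lborel"] by simp
    show "2 * f {m, n} + f {n} = 2 * g {m, n} + g {n}"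
      if "\<And>s. s \<in> entry_indices - {{m}} \<Longrightarrow> f s = g s" for f g :: "'n set \<Rightarrow> real"
      using that[of "{m, n}"] that[of "{n}"] mn by auto
    show "(\<lambda>f. F (sym_of_entries (T f))) \<in> borel_measurable ?P"
      using T by measurable
  qed auto
  finally have "(\<integral>\<^sup>+x. F x \<partial>sym_lborel) = ennreal (\<bar>det A\<bar> ^ (CARD('n) + 1)) *
      (\<integral>\<^sup>+x. F (A ** x ** transpose A) \<partial>sym_lborel)"
    by (simp add: nn_integral_sym_lborel act det)
  then show "(\<integral>\<^sup>+x. F x \<partial>sym_lborel) = ennreal (\<bar>det ?A\<bar> ^ (CARD('n) + 1)) *
      (\<integral>\<^sup>+x. F (?A ** x ** transpose ?A) \<partial>sym_lborel)"
    by (simp only: A_def)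
qed

text \<open>Every matrix is built from elementary ones, and both sides are compatible with products.
  Restriction to symmetric matrices makes the exponent \<open>r + 1\<close>; on all square matrices
  the same map has exponent \<open>2 * r\<close>.\<close>

lemma nn_integral_sym_lborel_congruence:
  fixes A :: "real^'n^'n"
  assumes "F \<in> borel_measurable borel" and "det A \<noteq> 0"
  shows "(\<integral>\<^sup>+x. F x \<partial>sym_lborel) =
    ennreal (\<bar>det A\<bar> ^ (CARD('n) + 1)) * (\<integral>\<^sup>+x. F (A ** x ** transpose A) \<partial>sym_lborel)"
proof -
  have "congruence_scales A"
  proof (rule induct_matrix_elementary_alt)
    show "congruence_scales (B ** C)" if "congruence_scales B" "congruence_scales C" for B C :: "real^'n^'n"
      using that by (rule congruence_scales_mult)
    show "congruence_scales B" if "row i B = 0" for B :: "real^'n^'n" and i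
      using det_zero_row(1)[OF that] by (simp add: congruence_scales_def)
    show "congruence_scales B" if "\<And>i j. i \<noteq> j \<Longrightarrow> B $ i $ j = 0" for B :: "real^'n^'n"
      using that by (rule congruence_scales_diagonal)
    show "congruence_scales (\<chi> i j. mat 1 $ i $ Transposition.transpose m n j :: real^'n^'n)" if "m \<noteq> n" for m n :: 'n
      using that by (rule congruence_scales_swap)
    show "congruence_scales (\<chi> i j. of_bool (i = m \<and> j = n \<or> i = j) :: real^'n^'n)" if "m \<noteq> n" for m n :: 'n
      using that by (rule congruence_scales_shear)
  qed
  then show ?thesis
    using assms unfolding congruence_scales_def by blast
qed

subsection \<open>The change of variables\<close>

lemma continuous_on_det [continuous_intros]:
  fixes f :: "'a::topological_space \<Rightarrow> real^'n^'n"
  assumes "continuous_on S f"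
  shows "continuous_on S (\<lambda>x. det (f x))"
  unfolding det_def by (intro continuous_intros assms)

lemma measurable_det [measurable]: "det \<in> borel_measurable (borel :: (real^'n^'n) measure)"
  using continuous_on_det[OF continuous_on_id] by (intro borel_measurable_continuous_onI)

lemma measurable_trace [measurable]: "trace \<in> borel_measurable (borel :: (real^'n^'n) measure)"
  unfolding trace_def by (intro borel_measurable_continuous_onI continuous_intros)

lemma measurable_component [measurable]:
  "(\<lambda>x. x $ i $ j) \<in> borel_measurable (borel :: (real^'n^'m) measure)"
  by (intro borel_measurable_continuous_onI continuous_intros)

lemma measurable_matrix_componentwise:
  fixes f :: "'a \<Rightarrow> real^'n^'m"
  assumes "\<And>i j. (\<lambda>x. f x $ i $ j) \<in> borel_measurable M"
  shows "f \<in> borel_measurable M"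
  using assms by (subst borel_measurable_euclidean_space) (auto simp: Basis_vec_def inner_axis)

lemma measurable_matrix_mult [measurable (raw)]:
  fixes f :: "'a \<Rightarrow> real^'n^'m" and g :: "'a \<Rightarrow> real^'k^'n"
  assumes [measurable]: "f \<in> borel_measurable M" "g \<in> borel_measurable M"
  shows "(\<lambda>x. f x ** g x) \<in> borel_measurable M"
proof (rule measurable_matrix_componentwise)
  fix i j
  have [measurable]: "(\<lambda>x. f x $ i $ k) \<in> borel_measurable M" "(\<lambda>x. g x $ k $ j) \<in> borel_measurable M" for k
    using measurable_compose[OF assms(1) measurable_component] measurable_compose[OF assms(2) measurable_component]
    by auto
  show "(\<lambda>x. (f x ** g x) $ i $ j) \<in> borel_measurable M"
    by (simp add: matrix_matrix_mult_def)
qed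

lemma
  fixes A :: "real^'n^'n"
  assumes "invertible A"
  shows matrix_inv_right: "A ** matrix_inv A = mat 1" and matrix_inv_left: "matrix_inv A ** A = mat 1"
  using someI_ex[of "\<lambda>B. A ** B = mat 1 \<and> B ** A = mat 1"] assms
  by (auto simp: matrix_inv_def invertible_def)

text \<open>Cramer's rule applied to the columns of the inverse. It exhibits the entries as
  quotients of determinants, which reduces measurability of the inverse to that of
  \<open>det\<close>.\<close>

lemma matrix_inv_component:
  fixes A :: "real^'n^'n"
  assumes "invertible A"
  shows "matrix_inv A $ k $ j = det (\<chi> i l. if l = k then axis j 1 $ i else A $ i $ l) / det A"
proof -
  have "A *v (matrix_inv A *v axis j 1) = axis j 1"
    by (simp add: matrix_vector_mul_assoc matrix_inv_right assms)
  then have "matrix_inv A *v axis j 1 = (\<chi> k. det (\<chi> i l. if l = k then axis j 1 $ i else A $ i $ l) / det A)"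
    using cramer[of A] assms by (simp add: invertible_det_nz)
  then have "(matrix_inv A *v axis j 1) $ k = det (\<chi> i l. if l = k then axis j 1 $ i else A $ i $ l) / det A"
    by simp
  then show ?thesis
    by (simp add: matrix_vector_mult_basis column_def)
qed

lemma measurable_matrix_inv:
  fixes f :: "'a \<Rightarrow> real^'n^'n"
  assumes f[measurable]: "f \<in> borel_measurable M" and inv: "\<And>x. invertible (f x)"
  shows "(\<lambda>x. matrix_inv (f x)) \<in> borel_measurable M"
proof (rule measurable_matrix_componentwise)
  fix k j
  have "continuous_on UNIV (\<lambda>A::real^'n^'n. if l = k then axis j 1 $ i else A $ i $ l)" for i l
    by (cases "l = k") (simp_all, intro continuous_intros)
  then have "(\<lambda>A::real^'n^'n. det (\<chi> i l. if l = k then axis j 1 $ i else A $ i $ l)) \<in> borel_measurable borel"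
    by (intro borel_measurable_continuous_onI continuous_intros)
  from measurable_compose[OF f this]
  have "(\<lambda>x. det (\<chi> i l. if l = k then axis j 1 $ i else f x $ i $ l) / det (f x)) \<in> borel_measurable M"
    by measurable
  then show "(\<lambda>x. matrix_inv (f x) $ k $ j) \<in> borel_measurable M"
    by (simp add: matrix_inv_component[OF inv])
qed

text \<open>
  The value outside the cone is chosen so that \<open>sqrt1p x\<close> is positive definite,
  hence invertible, for every \<open>x\<close>.
\<close>

definition sqrt1p :: "real^'n^'n \<Rightarrow> real^'n^'n" where
  "sqrt1p x = (if x \<in> pos_def_cone then msqrt (mat 1 + x) else mat 1)"

definition inv_sqrt1p :: "real^'n^'n \<Rightarrow> real^'n^'n" where
  "inv_sqrt1p x = matrix_inv (sqrt1p x)"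

lemma sqrt1p_pos_def: "sqrt1p x \<in> pos_def_cone"
  by (simp add: sqrt1p_def msqrt_pos_def pos_def_mat_1_add pos_def_mat_1)

lemma sqrt1p_square: "x \<in> pos_def_cone \<Longrightarrow> sqrt1p x ** sqrt1p x = mat 1 + x"
  by (simp add: sqrt1p_def msqrt_square pos_def_mat_1_add)

lemmas invertible_sqrt1p = pos_def_invertible[OF sqrt1p_pos_def]

lemma transpose_sqrt1p [simp]: "transpose (sqrt1p x) = sqrt1p x"
  by (rule pos_def_transpose[OF sqrt1p_pos_def])

lemma inv_sqrt1p_right [simp]: "sqrt1p x ** inv_sqrt1p x = mat 1"
  and inv_sqrt1p_left [simp]: "inv_sqrt1p x ** sqrt1p x = mat 1"
  by (simp_all add: inv_sqrt1p_def matrix_inv_right matrix_inv_left invertible_sqrt1p)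

lemma invertible_inv_sqrt1p: "invertible (inv_sqrt1p x)"
  using inv_sqrt1p_left inv_sqrt1p_right invertible_def by blast

lemma transpose_inv_sqrt1p [simp]: "transpose (inv_sqrt1p x) = inv_sqrt1p x"
proof -
  have "transpose (inv_sqrt1p x) ** sqrt1p x = transpose (sqrt1p x ** inv_sqrt1p x)"
    by (simp only: matrix_transpose_mul transpose_sqrt1p)
  also have "\<dots> = mat 1"
    by simp
  finally have "transpose (inv_sqrt1p x) ** sqrt1p x ** inv_sqrt1p x = inv_sqrt1p x"
    by simp
  then show ?thesis
    by (simp flip: matrix_mul_assoc)
qed

lemma sqrt1p_cancel:
  "inv_sqrt1p x ** (sqrt1p x ** y ** sqrt1p x) ** inv_sqrt1p x = y"
  "sqrt1p x ** (inv_sqrt1p x ** y ** inv_sqrt1p x) ** sqrt1p x = y"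
  by (metis inv_sqrt1p_left inv_sqrt1p_right matrix_mul_assoc matrix_mul_lid matrix_mul_rid)+

lemma pos_def_sqrt1p_congruence: "sqrt1p x ** y ** sqrt1p x \<in> pos_def_cone \<longleftrightarrow> y \<in> pos_def_cone"
  using pos_def_congruence[OF _ invertible_sqrt1p, of y x]
    pos_def_congruence[OF _ invertible_inv_sqrt1p, of "sqrt1p x ** y ** sqrt1p x" x]
  by (auto simp: sqrt1p_cancel)

lemma pos_def_inv_sqrt1p_congruence: "y \<in> pos_def_cone \<Longrightarrow> inv_sqrt1p x ** y ** inv_sqrt1p x \<in> pos_def_cone"
  using pos_def_congruence[OF _ invertible_inv_sqrt1p, of y x] by simp

lemma measurable_sqrt1p [measurable]: "sqrt1p \<in> borel \<rightarrow>\<^sub>M borel"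
proof -
  have "continuous_on pos_def_cone (\<lambda>x::real^'n^'n. msqrt (mat 1 + x))"
    by (rule continuous_on_compose2[OF continuous_on_msqrt])
       (auto intro!: continuous_intros pos_def_mat_1_add)
  then show ?thesis
    unfolding sqrt1p_def[abs_def]
    by (intro borel_measurable_continuous_on_if) auto
qed

lemma measurable_inv_sqrt1p [measurable]: "inv_sqrt1p \<in> borel \<rightarrow>\<^sub>M borel"
  unfolding inv_sqrt1p_def[abs_def] by (intro measurable_matrix_inv measurable_sqrt1p invertible_sqrt1p)

section \<open>Unnormalized densities and their substitution\<close>

definition kummer_weight :: "real \<Rightarrow> real \<Rightarrow> real \<Rightarrow> real^'n^'n \<Rightarrow> real" where
  "kummer_weight a b c x = det x powr (a - (real CARD('n) + 1) / 2) * det (mat 1 + x) powr (- (a + b))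
     * exp (- trace ((c *\<^sub>R mat 1) ** x)) * indicator pos_def_cone x"

definition wishart_weight :: "real \<Rightarrow> real \<Rightarrow> real^'n^'n \<Rightarrow> real" where
  "wishart_weight b c y = det y powr (b - (real CARD('n) + 1) / 2) * exp (- trace ((c *\<^sub>R mat 1) ** y))
     * indicator pos_def_cone y"

text \<open>Up to a constant, the joint density of \<open>X\<close> and \<open>U\<close>.\<close>

definition joint_weight :: "real \<Rightarrow> real \<Rightarrow> real \<Rightarrow> real^'n^'n \<Rightarrow> real^'n^'n \<Rightarrow> real" where
  "joint_weight \<alpha> \<beta> c x u = det x powr (\<alpha> - (real CARD('n) + 1) / 2) * det u powr (\<beta> - (real CARD('n) + 1) / 2)
     * exp (- c * (trace x + trace u + trace (x ** u))) * indicator pos_def_cone x * indicator pos_def_cone u"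

lemma joint_weight_commute: "joint_weight \<alpha> \<beta> c x u = joint_weight \<beta> \<alpha> c u x"
  by (simp add: joint_weight_def trace_mul_sym[of x u] ac_simps)

lemma measurable_kummer_weight [measurable]: "kummer_weight a b c \<in> borel_measurable borel"
  unfolding kummer_weight_def[abs_def] by measurable

lemma measurable_wishart_weight [measurable]: "wishart_weight b c \<in> borel_measurable borel"
  unfolding wishart_weight_def[abs_def] by measurable

lemma measurable_joint_weight [measurable]:
  "(\<lambda>(x, u). joint_weight \<alpha> \<beta> c x u) \<in> borel_measurable (borel \<Otimes>\<^sub>M borel)"
  unfolding joint_weight_def[abs_def] by measurable

lemma weights_nonneg [simp]:
  "kummer_weight a b c x \<ge> 0" "wishart_weight b c x \<ge> 0" "joint_weight a b c x y \<ge> 0"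
  by (simp_all add: kummer_weight_def wishart_weight_def joint_weight_def)

lemma trace_scaleR_mat_1: "trace ((c *\<^sub>R mat 1) ** x) = c * trace (x :: real^'n^'n)"
  by (simp add: trace_def sum_distrib_left matrix_matrix_mult_def mat_def if_distrib[of "\<lambda>x. x * _"]
      if_distrib[of "\<lambda>x. _ * x"] cong: if_cong)

text \<open>The powers of \<open>det (mat 1 + x)\<close> are \<open>- (a + b)\<close> from the
  Kummer weight, \<open>a + b - ?p\<close> from the Wishart weight and \<open>?p\<close> from the
  Jacobian; they cancel. Congruence by \<open>sqrt1p x\<close> preserves membership in the cone in
  both directions, so the indicators match too.\<close>

lemma weight_factorization:
  fixes x u :: "real^'n^'n"
  assumes x: "x \<in> pos_def_cone"
  shows "kummer_weight a b c x * wishart_weight (a + b) c (sqrt1p x ** u ** sqrt1p x)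
      * \<bar>det (sqrt1p x)\<bar> ^ (CARD('n) + 1) = joint_weight a (a + b) c x u"
proof (cases "u \<in> pos_def_cone")
  case True
  let ?p = "(real CARD('n) + 1) / 2" and ?T = "sqrt1p x" and ?D = "det (mat 1 + x)"
  have D: "?D > 0" "?D = det ?T * det ?T" and u: "det u > 0" and T: "det ?T > 0"
    using pos_def_det_pos[OF pos_def_mat_1_add[OF x]] pos_def_det_pos[OF True] pos_def_det_pos[OF sqrt1p_pos_def]
      sqrt1p_square[OF x] by (auto simp flip: det_mul)
  \<comment> \<open>The exponent of \<open>det ?T\<close> is twice \<open>?p\<close>, and
    \<open>?D\<close> is the square of \<open>det ?T\<close>: this converts the Jacobian into a
    power of \<open>?D\<close>.\<close>
  have "?p + ?p = real (CARD('n) + 1)"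
    by (simp add: field_simps)
  then have "\<bar>det ?T\<bar> ^ (CARD('n) + 1) = det ?T powr (?p + ?p)"
    using T by (simp only: powr_realpow abs_of_pos)
  also have "\<dots> = ?D powr ?p"
    by (simp only: D(2) powr_mult powr_add)
  finally have jac: "\<bar>det ?T\<bar> ^ (CARD('n) + 1) = ?D powr ?p" .
  have "det (?T ** u ** ?T) = ?D * det u"
    by (simp add: det_mul D(2))
  then have d: "det (?T ** u ** ?T) powr (a + b - ?p) = ?D powr (a + b - ?p) * det u powr (a + b - ?p)"
    using D u by (simp add: powr_mult)
  have Dp: "?D powr (- (a + b)) * ?D powr (a + b - ?p) * ?D powr ?p = 1"
    using D(1) by (simp flip: powr_add)
  \<comment> \<open>The matrix parameter is the scalar \<open>c *\<^sub>R mat 1\<close>, so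
    cyclicity of the trace may merge the two factors \<open>?T\<close> into
    \<open>mat 1 + x\<close>; the square root disappears from the exponent.\<close>
  have "trace (?T ** u ** ?T) = trace (?T ** ?T ** u)"
    by (metis matrix_mul_assoc trace_mul_sym)
  also have "\<dots> = trace u + trace (x ** u)"
    by (simp add: sqrt1p_square[OF x] trace_mul_sym[of "mat 1 + x" u] trace_mul_sym[of u x] matrix_add_ldistrib trace_add)
  finally have tr: "trace (?T ** u ** ?T) = trace u + trace (x ** u)" .
  have e: "exp (- trace ((c *\<^sub>R mat 1) ** x)) * exp (- trace ((c *\<^sub>R mat 1) ** (?T ** u ** ?T)))
      = exp (- c * (trace x + trace u + trace (x ** u)))"
    by (simp add: trace_scaleR_mat_1 tr algebra_simps flip: exp_add)
  have "kummer_weight a b c x * wishart_weight (a + b) c (?T ** u ** ?T) * \<bar>det ?T\<bar> ^ (CARD('n) + 1)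
    = det x powr (a - ?p) * det u powr (a + b - ?p)
      * (exp (- trace ((c *\<^sub>R mat 1) ** x)) * exp (- trace ((c *\<^sub>R mat 1) ** (?T ** u ** ?T))))
      * (?D powr (- (a + b)) * ?D powr (a + b - ?p) * ?D powr ?p)"
    using x True unfolding kummer_weight_def wishart_weight_def jac d
    by (simp only: indicator_def pos_def_sqrt1p_congruence if_True of_bool_eq mult_1_right ac_simps)
  then show ?thesis
    using x True unfolding Dp e by (simp add: joint_weight_def)
qed (simp add: joint_weight_def wishart_weight_def pos_def_sqrt1p_congruence)

text \<open>At fixed \<open>x\<close> in the cone this is the congruence substitution by
  \<open>sqrt1p x\<close>; off the cone both weights vanish. A general \<Phi> allows the identity to
  be used once forwards and once backwards.\<close>

lemma nn_integral_joint_weight: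
  fixes \<Phi> :: "(real^'n^'n) \<times> (real^'n^'n) \<Rightarrow> ennreal"
  assumes \<Phi>[measurable]: "\<Phi> \<in> borel_measurable (borel \<Otimes>\<^sub>M borel)"
  shows "(\<integral>\<^sup>+x. \<integral>\<^sup>+y. ennreal (kummer_weight a b c x) * ennreal (wishart_weight (a + b) c y)
      * \<Phi> (x, inv_sqrt1p x ** y ** inv_sqrt1p x) \<partial>sym_lborel \<partial>sym_lborel) =
    (\<integral>\<^sup>+x. \<integral>\<^sup>+u. ennreal (joint_weight a (a + b) c x u) * \<Phi> (x, u) \<partial>sym_lborel \<partial>sym_lborel)"
proof (rule nn_integral_cong)
  fix x :: "real^'n^'n"
  let ?F = "\<lambda>y. ennreal (kummer_weight a b c x) * ennreal (wishart_weight (a + b) c y)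
      * \<Phi> (x, inv_sqrt1p x ** y ** inv_sqrt1p x)"
  show "(\<integral>\<^sup>+y. ?F y \<partial>sym_lborel) = (\<integral>\<^sup>+u. ennreal (joint_weight a (a + b) c x u) * \<Phi> (x, u) \<partial>sym_lborel)"
  proof (cases "x \<in> pos_def_cone")
    case True
    let ?T = "sqrt1p x"
    have F[measurable]: "?F \<in> borel_measurable borel"
      by measurable
    have FT: "(\<lambda>u. ?F (?T ** u ** ?T)) \<in> borel_measurable sym_lborel"
      by measurable
    have "(\<integral>\<^sup>+y. ?F y \<partial>sym_lborel) =
        ennreal (\<bar>det ?T\<bar> ^ (CARD('n) + 1)) * (\<integral>\<^sup>+u. ?F (?T ** u ** ?T) \<partial>sym_lborel)"
      using nn_integral_sym_lborel_congruence[OF F, of ?T] invertible_sqrt1p[of x]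
      by (simp add: invertible_det_nz)
    also have "\<dots> = (\<integral>\<^sup>+u. ennreal (\<bar>det ?T\<bar> ^ (CARD('n) + 1)) * ?F (?T ** u ** ?T) \<partial>sym_lborel)"
      by (rule nn_integral_cmult[OF FT, symmetric])
    also have "\<dots> = (\<integral>\<^sup>+u. ennreal (joint_weight a (a + b) c x u) * \<Phi> (x, u) \<partial>sym_lborel)"
      by (intro nn_integral_cong)
         (simp add: sqrt1p_cancel weight_factorization[OF True, symmetric] ennreal_mult ac_simps)
    finally show ?thesis .
  qed (simp add: kummer_weight_def joint_weight_def)
qed

lemma nn_integral_kummer_wishart:
  fixes G :: "(real^'n^'n) \<times> (real^'n^'n) \<Rightarrow> ennreal"
  assumes G[measurable]: "G \<in> borel_measurable (borel \<Otimes>\<^sub>M borel)"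
  shows "(\<integral>\<^sup>+x. \<integral>\<^sup>+y. ennreal (kummer_weight a b c x) * ennreal (wishart_weight (a + b) c y)
      * (let u = inv_sqrt1p x ** y ** inv_sqrt1p x in G (u, sqrt1p u ** x ** sqrt1p u)) \<partial>sym_lborel \<partial>sym_lborel) =
    (\<integral>\<^sup>+u. \<integral>\<^sup>+v. ennreal (kummer_weight (a + b) (- b) c u) * ennreal (wishart_weight a c v)
      * G (u, v) \<partial>sym_lborel \<partial>sym_lborel)"
proof -
  interpret sigma_finite_measure "sym_lborel :: (real^'n^'n) measure"
    by (rule sigma_finite_sym_lborel)
  interpret pair_sigma_finite "sym_lborel :: (real^'n^'n) measure" "sym_lborel :: (real^'n^'n) measure" ..
  have "(\<integral>\<^sup>+x. \<integral>\<^sup>+y. ennreal (kummer_weight a b c x) * ennreal (wishart_weight (a + b) c y)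
      * (let u = inv_sqrt1p x ** y ** inv_sqrt1p x in G (u, sqrt1p u ** x ** sqrt1p u)) \<partial>sym_lborel \<partial>sym_lborel) =
    (\<integral>\<^sup>+x. \<integral>\<^sup>+u. ennreal (joint_weight a (a + b) c x u) * G (u, sqrt1p u ** x ** sqrt1p u) \<partial>sym_lborel \<partial>sym_lborel)"
    using nn_integral_joint_weight[of "\<lambda>(x, u). G (u, sqrt1p u ** x ** sqrt1p u)" a b c] by (simp add: Let_def)
  also have "\<dots> =
    (\<integral>\<^sup>+u. \<integral>\<^sup>+x. ennreal (joint_weight a (a + b) c x u) * G (u, sqrt1p u ** x ** sqrt1p u) \<partial>sym_lborel \<partial>sym_lborel)"
    by (rule Fubini'[symmetric]) measurable
  also have "\<dots> =
    (\<integral>\<^sup>+u. \<integral>\<^sup>+v. ennreal (kummer_weight (a + b) (- b) c u) * ennreal (wishart_weight a c v)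
      * G (u, v) \<partial>sym_lborel \<partial>sym_lborel)"
    \<comment> \<open>Here \<open>(a + b) + (- b) = a\<close>, so the Wishart parameter becomes
      \<open>a\<close>. The test function contains \<open>sqrt1p u\<close>, which cancels against
      the substitution and leaves \<open>G (u, v)\<close>.\<close>
    using nn_integral_joint_weight[of "\<lambda>(u, x). G (u, sqrt1p u ** x ** sqrt1p u)" "a + b" "- b" c]
    by (simp add: sqrt1p_cancel joint_weight_commute[of a "a + b"])
  finally show ?thesis .
qed

section \<open>Normalized laws and their products\<close>

text \<open>The total mass is \<open>?Z / ?Z\<close>, which in \<open>ennreal\<close> is 0 rather
  than 1 when \<open>?Z\<close> is 0 or infinite. Thus a random variable having such a law certifies
  that the normalizing integral is positive and finite.\<close>

lemma prob_space_law_proportional_to: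
  assumes [measurable]: "f \<in> borel_measurable N"
  shows "prob_space (law_proportional_to N f) \<longleftrightarrow>
    0 < (\<integral>\<^sup>+x. ennreal (f x) \<partial>N) \<and> (\<integral>\<^sup>+x. ennreal (f x) \<partial>N) < \<infinity>"
proof -
  let ?Z = "\<integral>\<^sup>+x. ennreal (f x) \<partial>N"
  have "emeasure (law_proportional_to N f) (space N) = (\<integral>\<^sup>+x. ennreal (f x) / ?Z \<partial>N)"
    by (simp add: law_proportional_to_def emeasure_density cong: nn_integral_cong)
  also have "\<dots> = ?Z / ?Z"
    by (rule nn_integral_divide) measurable
  finally have "prob_space (law_proportional_to N f) \<longleftrightarrow> ?Z / ?Z = 1"
    using prob_spaceI[of "law_proportional_to N f"] prob_space.emeasure_space_1[of "law_proportional_to N f"]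
    by (auto simp: law_proportional_to_def)
  also have "\<dots> \<longleftrightarrow> 0 < ?Z \<and> ?Z < \<infinity>"
    by (cases "?Z = 0 \<or> ?Z = \<infinity>") (auto simp: ennreal_divide_self less_top zero_less_iff_neq_zero)
  finally show ?thesis .
qed

lemma nn_integral_pair_law_proportional_to:
  assumes f[measurable]: "f \<in> borel_measurable N" and g[measurable]: "g \<in> borel_measurable N"
    and H[measurable]: "H \<in> borel_measurable (N \<Otimes>\<^sub>M N)" and N: "sigma_finite_measure N"
    and pf: "prob_space (law_proportional_to N f)" and pg: "prob_space (law_proportional_to N g)"
  shows "(\<integral>\<^sup>+z. H z \<partial>(law_proportional_to N f \<Otimes>\<^sub>M law_proportional_to N g)) =
    (\<integral>\<^sup>+x. \<integral>\<^sup>+y. ennreal (f x) * ennreal (g y) * H (x, y) \<partial>N \<partial>N)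
      / ((\<integral>\<^sup>+x. ennreal (f x) \<partial>N) * (\<integral>\<^sup>+x. ennreal (g x) \<partial>N))"
proof -
  interpret N: sigma_finite_measure N by fact
  interpret g: prob_space "law_proportional_to N g" by fact
  let ?Z = "\<integral>\<^sup>+x. ennreal (f x) \<partial>N" and ?W = "\<integral>\<^sup>+x. ennreal (g x) \<partial>N"
  have ZW: "?Z \<noteq> 0" "?W \<noteq> 0" "?Z \<noteq> \<infinity>" "?W \<noteq> \<infinity>"
    using pf pg by (simp_all add: prob_space_law_proportional_to less_top zero_less_iff_neq_zero)
  \<comment> \<open>In \<open>ennreal\<close> this rule fails for 0 times infinity, a case excluded
    by \<open>ZW\<close>.\<close>
  have inv: "inverse (?Z * ?W) = inverse ?Z * inverse ?W"
    using ZW by (intro ennreal_inverse_mult) (auto simp: less_top)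
  have sets: "sets (law_proportional_to N f) = sets N" "sets (law_proportional_to N g) = sets N"
    by (simp_all add: law_proportional_to_def)
  have H': "H \<in> borel_measurable (law_proportional_to N f \<Otimes>\<^sub>M law_proportional_to N g)"
    using H by (simp cong: measurable_cong_sets sets_pair_measure_cong add: sets)
  have "(\<integral>\<^sup>+z. H z \<partial>(law_proportional_to N f \<Otimes>\<^sub>M law_proportional_to N g)) =
      (\<integral>\<^sup>+x. \<integral>\<^sup>+y. H (x, y) \<partial>law_proportional_to N g \<partial>law_proportional_to N f)"
    by (rule g.nn_integral_fst[OF H', symmetric])
  also have "\<dots> = (\<integral>\<^sup>+x. ennreal (f x) / ?Z * (\<integral>\<^sup>+y. ennreal (g y) / ?W * H (x, y) \<partial>N) \<partial>N)"
  proof -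
    have "(\<integral>\<^sup>+y. H (x, y) \<partial>law_proportional_to N g) = (\<integral>\<^sup>+y. ennreal (g y) / ?W * H (x, y) \<partial>N)"
      if [measurable]: "x \<in> space N" for x
      unfolding law_proportional_to_def by (rule nn_integral_density) measurable
    then have "(\<integral>\<^sup>+x. \<integral>\<^sup>+y. H (x, y) \<partial>law_proportional_to N g \<partial>law_proportional_to N f) =
        (\<integral>\<^sup>+x. (\<integral>\<^sup>+y. ennreal (g y) / ?W * H (x, y) \<partial>N) \<partial>law_proportional_to N f)"
      by (intro nn_integral_cong) (simp add: law_proportional_to_def)
    also have "\<dots> = (\<integral>\<^sup>+x. ennreal (f x) / ?Z * (\<integral>\<^sup>+y. ennreal (g y) / ?W * H (x, y) \<partial>N) \<partial>N)"
      unfolding law_proportional_to_def[of N f] by (rule nn_integral_density) measurable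
    finally show ?thesis .
  qed
  also have "\<dots> = (\<integral>\<^sup>+x. (\<integral>\<^sup>+y. ennreal (f x) * ennreal (g y) * H (x, y) \<partial>N) / (?Z * ?W) \<partial>N)"
  proof (rule nn_integral_cong)
    fix x assume [measurable]: "x \<in> space N"
    have "ennreal (f x) / ?Z * (\<integral>\<^sup>+y. ennreal (g y) / ?W * H (x, y) \<partial>N) =
        (\<integral>\<^sup>+y. ennreal (f x) / ?Z * (ennreal (g y) / ?W * H (x, y)) \<partial>N)"
      by (subst nn_integral_cmult) auto
    also have "\<dots> = (\<integral>\<^sup>+y. ennreal (f x) * ennreal (g y) * H (x, y) / (?Z * ?W) \<partial>N)"
      by (intro nn_integral_cong) (simp add: divide_ennreal_def inv ac_simps)
    also have "\<dots> = (\<integral>\<^sup>+y. ennreal (f x) * ennreal (g y) * H (x, y) \<partial>N) / (?Z * ?W)"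
      by (rule nn_integral_divide) measurable
    finally show "ennreal (f x) / ?Z * (\<integral>\<^sup>+y. ennreal (g y) / ?W * H (x, y) \<partial>N) =
        (\<integral>\<^sup>+y. ennreal (f x) * ennreal (g y) * H (x, y) \<partial>N) / (?Z * ?W)" .
  qed
  also have "\<dots> = (\<integral>\<^sup>+x. \<integral>\<^sup>+y. ennreal (f x) * ennreal (g y) * H (x, y) \<partial>N \<partial>N) / (?Z * ?W)"
    by (rule nn_integral_divide) measurable
  finally show ?thesis .
qed

lemma nn_integral_nn_integral_mult:
  assumes f[measurable]: "f \<in> borel_measurable N" and g[measurable]: "g \<in> borel_measurable N"
  shows "(\<integral>\<^sup>+x. \<integral>\<^sup>+y. f x * g y \<partial>N \<partial>N) = (\<integral>\<^sup>+x. f x \<partial>N) * (\<integral>\<^sup>+y. g y \<partial>N)"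
  by (simp add: nn_integral_cmult nn_integral_multc)

lemma matrix_kummer_eq: "matrix_kummer a b (c *\<^sub>R mat 1) = law_proportional_to sym_lborel (kummer_weight a b c)"
  by (simp add: matrix_kummer_def kummer_weight_def[abs_def])

lemma wishart_eq: "wishart b (c *\<^sub>R mat 1) = law_proportional_to sym_lborel (wishart_weight b c)"
  by (simp add: wishart_def wishart_weight_def[abs_def])

theorem theorem3p2:
  fixes M :: "'a measure" and X Y U V :: "'a \<Rightarrow> real^'n^'n" and a b c :: real
  assumes "prob_space M"
    and "a > (real CARD('n) - 1) / 2"
    and "b > (real CARD('n) - 1) / 2 - a"
    and "c > 0"
    and "\<And>\<omega>. \<omega> \<in> space M \<Longrightarrow> X \<omega> \<in> pos_def_cone"
    and "\<And>\<omega>. \<omega> \<in> space M \<Longrightarrow> Y \<omega> \<in> pos_def_cone"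
    and "prob_space.indep_var M borel X borel Y"
    and "distr M borel X = matrix_kummer a b (c *\<^sub>R mat 1)"
    and "distr M borel Y = wishart (a + b) (c *\<^sub>R mat 1)"
    and "U = (\<lambda>\<omega>. quad_rep (matrix_inv (msqrt (mat 1 + X \<omega>))) (Y \<omega>))"
    and "V = (\<lambda>\<omega>. quad_rep (msqrt (mat 1 + U \<omega>)) (X \<omega>))"
  shows "prob_space.indep_var M borel U borel V
    \<and> distr M borel U = matrix_kummer (a + b) (- b) (c *\<^sub>R mat 1)
    \<and> distr M borel V = wishart a (c *\<^sub>R mat 1)"
proof -
  interpret M: prob_space M by fact
  define L :: "(real^'n^'n) measure" where "L = sym_lborel"
  let ?f = "kummer_weight a b c :: real^'n^'n \<Rightarrow> real" and ?g = "wishart_weight (a + b) c :: real^'n^'n \<Rightarrow> real"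
  let ?f' = "kummer_weight (a + b) (- b) c :: real^'n^'n \<Rightarrow> real" and ?g' = "wishart_weight a c :: real^'n^'n \<Rightarrow> real"
  have setsL [measurable_cong]: "sets L = sets borel"
    by (simp add: L_def sets_sym_lborel)
  have sigma: "sigma_finite_measure L"
    by (simp add: L_def sigma_finite_sym_lborel)
  have X[measurable]: "X \<in> M \<rightarrow>\<^sub>M borel" and Y[measurable]: "Y \<in> M \<rightarrow>\<^sub>M borel"
    using assms(7) M.indep_var_rv1 M.indep_var_rv2 by blast+
  have distrX: "distr M borel X = law_proportional_to L ?f" and distrY: "distr M borel Y = law_proportional_to L ?g"
    using assms(8,9) by (simp_all add: matrix_kummer_eq wishart_eq L_def)
  have pf: "prob_space (law_proportional_to L ?f)" and pg: "prob_space (law_proportional_to L ?g)"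
    using M.prob_space_distr[OF X] M.prob_space_distr[OF Y] by (simp_all add: distrX distrY)
  \<comment> \<open>With \<open>sqrt1p\<close> in place of \<open>msqrt\<close>, the map is Borel on
    all pairs of matrices. It reproduces \<open>(U, V)\<close> because \<open>X\<close>,
    \<open>Y\<close>, and therefore \<open>U\<close>, take values in the cone.\<close>
  define \<tau> where "\<tau> = (\<lambda>(x, y). let u = inv_sqrt1p x ** y ** inv_sqrt1p x in (u, sqrt1p u ** x ** sqrt1p u) :: (real^'n^'n) \<times> (real^'n^'n))"
  have \<tau>[measurable]: "\<tau> \<in> borel \<Otimes>\<^sub>M borel \<rightarrow>\<^sub>M borel \<Otimes>\<^sub>M borel"
    unfolding \<tau>_def Let_def by measurable
  have UV: "(U \<omega>, V \<omega>) = \<tau> (X \<omega>, Y \<omega>)" if "\<omega> \<in> space M" for \<omega>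
  proof -
    have "U \<omega> = inv_sqrt1p (X \<omega>) ** Y \<omega> ** inv_sqrt1p (X \<omega>)"
      using assms(5)[OF that] by (simp add: assms(10) quad_rep_def inv_sqrt1p_def sqrt1p_def)
    moreover from this have "U \<omega> \<in> pos_def_cone"
      using assms(6)[OF that] by (simp add: pos_def_inv_sqrt1p_congruence)
    then have "V \<omega> = sqrt1p (U \<omega>) ** X \<omega> ** sqrt1p (U \<omega>)"
      by (simp add: assms(11) quad_rep_def sqrt1p_def)
    ultimately show ?thesis
      by (simp add: \<tau>_def Let_def)
  qed
  \<comment> \<open>Measurability of \<open>U\<close> and \<open>V\<close> is inherited from the
    components of \<tau>, with which they agree on \<open>space M\<close>.\<close>
  have "(\<lambda>\<omega>. fst (\<tau> (X \<omega>, Y \<omega>))) \<in> M \<rightarrow>\<^sub>M borel" "(\<lambda>\<omega>. snd (\<tau> (X \<omega>, Y \<omega>))) \<in> M \<rightarrow>\<^sub>M borel"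
    by measurable
  then have U[measurable]: "U \<in> M \<rightarrow>\<^sub>M borel" and V[measurable]: "V \<in> M \<rightarrow>\<^sub>M borel"
    by (auto simp flip: UV cong: measurable_cong)
  have change: "(\<integral>\<^sup>+x. \<integral>\<^sup>+y. ennreal (?f x) * ennreal (?g y) * G (\<tau> (x, y)) \<partial>L \<partial>L) =
      (\<integral>\<^sup>+u. \<integral>\<^sup>+v. ennreal (?f' u) * ennreal (?g' v) * G (u, v) \<partial>L \<partial>L)"
    if "G \<in> borel_measurable (borel \<Otimes>\<^sub>M borel)" for G
    using nn_integral_kummer_wishart[OF that, of a b c] by (simp add: \<tau>_def L_def Let_def)
  let ?I = "\<lambda>h. \<integral>\<^sup>+x. ennreal (h x) \<partial>L"
  \<comment> \<open>The constant test function 1 shows that the two products of normalizing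
    integrals agree.\<close>
  have ZW: "?I ?f * ?I ?g = ?I ?f' * ?I ?g'"
    using change[of "\<lambda>_. 1"] by (simp add: nn_integral_nn_integral_mult)
  have "?I ?f * ?I ?g \<noteq> 0" "?I ?f * ?I ?g \<noteq> \<infinity>"
    using pf pg by (auto simp: prob_space_law_proportional_to ennreal_mult_eq_top_iff)
  \<comment> \<open>A product in \<open>ennreal\<close> that is neither 0 nor infinite has no factor
    that is 0 or infinite, so both target laws are probability measures.\<close>
  then have pf': "prob_space (law_proportional_to L ?f')" and pg': "prob_space (law_proportional_to L ?g')"
    unfolding ZW by (auto simp: prob_space_law_proportional_to ennreal_mult_eq_top_iff less_top zero_less_iff_neq_zero)
  let ?K = "law_proportional_to L ?f'" and ?W = "law_proportional_to L ?g'"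
  have sets: "sets ?K = sets borel" "sets ?W = sets borel"
    by (simp_all add: law_proportional_to_def setsL)
  have joint: "distr M (borel \<Otimes>\<^sub>M borel) (\<lambda>\<omega>. (U \<omega>, V \<omega>)) = ?K \<Otimes>\<^sub>M ?W"
  proof (rule measure_eqI)
    show "sets (distr M (borel \<Otimes>\<^sub>M borel) (\<lambda>\<omega>. (U \<omega>, V \<omega>))) = sets (?K \<Otimes>\<^sub>M ?W)"
      by (simp add: sets cong: sets_pair_measure_cong)
    fix S assume "S \<in> sets (distr M (borel \<Otimes>\<^sub>M borel) (\<lambda>\<omega>. (U \<omega>, V \<omega>)))"
    then have S[measurable]: "S \<in> sets (borel \<Otimes>\<^sub>M borel)"
      by simp
    have "emeasure (distr M (borel \<Otimes>\<^sub>M borel) (\<lambda>\<omega>. (U \<omega>, V \<omega>))) S = (\<integral>\<^sup>+\<omega>. indicator S (U \<omega>, V \<omega>) \<partial>M)"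
      by (subst nn_integral_distr[symmetric, of _ M "borel \<Otimes>\<^sub>M borel"]) auto
    also have "\<dots> = (\<integral>\<^sup>+\<omega>. indicator S (\<tau> (X \<omega>, Y \<omega>)) \<partial>M)"
      by (intro nn_integral_cong) (simp add: UV)
    also have "\<dots> = (\<integral>\<^sup>+z. indicator S (\<tau> z) \<partial>distr M (borel \<Otimes>\<^sub>M borel) (\<lambda>\<omega>. (X \<omega>, Y \<omega>)))"
      by (subst nn_integral_distr) auto
    also have "distr M (borel \<Otimes>\<^sub>M borel) (\<lambda>\<omega>. (X \<omega>, Y \<omega>)) = law_proportional_to L ?f \<Otimes>\<^sub>M law_proportional_to L ?g"
      using assms(7) unfolding M.indep_var_distribution_eq distrX distrY by simp
    also have "(\<integral>\<^sup>+z. indicator S (\<tau> z) \<partial>(law_proportional_to L ?f \<Otimes>\<^sub>M law_proportional_to L ?g)) =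
        (\<integral>\<^sup>+x. \<integral>\<^sup>+y. ennreal (?f x) * ennreal (?g y) * indicator S (\<tau> (x, y)) \<partial>L \<partial>L) / (?I ?f * ?I ?g)"
      by (rule nn_integral_pair_law_proportional_to[OF _ _ _ sigma pf pg]) measurable
    also have "\<dots> = (\<integral>\<^sup>+u. \<integral>\<^sup>+v. ennreal (?f' u) * ennreal (?g' v) * indicator S (u, v) \<partial>L \<partial>L) / (?I ?f' * ?I ?g')"
      using change[of "indicator S"] by (simp add: ZW)
    also have "\<dots> = (\<integral>\<^sup>+z. indicator S z \<partial>(?K \<Otimes>\<^sub>M ?W))"
      by (rule nn_integral_pair_law_proportional_to[OF _ _ _ sigma pf' pg', symmetric]) measurable
    also have "\<dots> = emeasure (?K \<Otimes>\<^sub>M ?W) S"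
      using S by (intro nn_integral_indicator) (simp add: sets cong: sets_pair_measure_cong)
    finally show "emeasure (distr M (borel \<Otimes>\<^sub>M borel) (\<lambda>\<omega>. (U \<omega>, V \<omega>))) S = emeasure (?K \<Otimes>\<^sub>M ?W) S" .
  qed
  have "distr M borel U = distr (?K \<Otimes>\<^sub>M ?W) borel fst"
    by (subst joint[symmetric], subst distr_distr) (auto simp: o_def)
  also have "\<dots> = distr (?K \<Otimes>\<^sub>M ?W) ?K fst"
    by (intro distr_cong) (simp_all add: sets)
  also have "\<dots> = ?K"
    by (rule prob_space.distr_pair_fst[OF pg'])
  finally have distrU: "distr M borel U = ?K" .
  have "distr M borel V = distr (?K \<Otimes>\<^sub>M ?W) borel snd"
    by (subst joint[symmetric], subst distr_distr) (auto simp: o_def)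
  also have "\<dots> = ?W"
  proof (rule measure_eqI)
    interpret W: prob_space ?W by (rule pg')
    fix A assume "A \<in> sets (distr (?K \<Otimes>\<^sub>M ?W) borel snd)"
    then have A: "A \<in> sets borel"
      by simp
    have "snd -` A \<inter> space (?K \<Otimes>\<^sub>M ?W) = space ?K \<times> A"
      using sets_eq_imp_space_eq[OF sets(2)] by (auto simp: space_pair_measure)
    then have "emeasure (distr (?K \<Otimes>\<^sub>M ?W) borel snd) A = emeasure ?K (space ?K) * emeasure ?W A"
      using A sets by (subst emeasure_distr)
        (auto simp: W.emeasure_pair_measure_Times measurable_cong_sets[OF refl sets(2)[symmetric]])
    then show "emeasure (distr (?K \<Otimes>\<^sub>M ?W) borel snd) A = emeasure ?W A"
      using prob_space.emeasure_space_1[OF pf'] by simp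
  qed (simp add: sets)
  finally have distrV: "distr M borel V = ?W" .
  have "M.indep_var borel U borel V"
    unfolding M.indep_var_distribution_eq distrU distrV joint using U V by simp
  then show ?thesis
    using distrU distrV by (simp add: matrix_kummer_eq wishart_eq L_def)
qed

end
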